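(* Let $(\mathcal B,\otimes,I)$ be a cartesian bicategory. Then the functor $\mathcal R(\mathcal B)=\mathrm{Hom}_{\mathcal B}(-,I)\colon \mathrm{Map}(\mathcal B)^{op}\to\mathbf{InfSL}$ is an elementary existential doctrine.
   Context: Composition is written diagrammatically as $f;g$ (first $f$, then $g$). A cartesian bicategory is a symmetric monoidal category $(\mathcal B,\otimes,I)$ enriched in posets (each hom-set is a partial order and both composition and $\otimes$ are monotone), in which every object $X$ is equipped with morphisms $d_X\colon X\to X\otimes X$ and $e_X\colon X\to I$ such that: (1) $(d_X,e_X)$ is a cocommutative comonoid; (2) $d_X$ and $e_X$ have right adjoints $d_X^*\colon X\otimes X\to X$ and $e_X^*\colon I\to X$, i.e. $\mathrm{id}_X\le d_X;d_X^*$, $d_X^*;d_X\le\mathrm{id}_{X\otimes X}$, $\mathrm{id}_X\le e_X;e_X^*$, $e_X^*;e_X\le\mathrm{id}_I$; (3) the Frobenius law $(d_X\otimes\mathrm{id}_X);(\mathrm{id}_X\otimes d_X^* )=d_X^*;d_X$ holds; (4) every morphism $R\colon X\to Y$ is a lax comonoid homomorphism: $R;d_Y\le d_X;(R\otimes R)$ and $R;e_Y\le e_X$; (5) the comonoids are coherent with the monoidal structure: $e_{X\otimes Y}=e_X\otimes e_Y$ and $d_{X\otimes Y}=(d_X\otimes d_Y);(\mathrm{id}_X\otimes\sigma_{X,Y}\otimes\mathrm{id}_Y)$ (modulo the coherence isomorphisms, including $I\otimes I\cong I$), with $d_I,e_I$ the canonical isomorphisms. A map is a morphism $f\colon X\to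 Y$ with $f;d_Y=d_X;(f\otimes f)$ and $f;e_Y=e_X$; maps form a subcategory $\mathrm{Map}(\mathcal B)$, which is a cartesian category (chosen finite products) with product $\otimes$, terminal object $I$, diagonals $d_X$ and terminal maps $e_X$. Each $\mathrm{Hom}_{\mathcal B}(X,I)$ is a meet-semilattice with top $e_X$ and meet $R\wedge S=d_X;(R\otimes S)$ (followed by $I\otimes I\cong I$), and for a map $f\colon X\to Y$ the function $U\mapsto f;U$ preserves finite meets; $\mathcal R(\mathcal B)$ sends $X$ to $\mathrm{Hom}_{\mathcal B}(X,I)$ and a map $f\colon X\to Y$ to $U\mapsto f;U$. $\mathbf{InfSL}$ is the category of meet-semilattices with top and maps preserving finite meets and top. Elementary existential doctrine: let $\mathcal C$ be a cartesian category with chosen products $\times$, projections $\pi_i$, pairing $\langle-,-\rangle$, terminal object $I$ and diagonals $\Delta_A=\langle\mathrm{id},\mathrm{id}\rangle$. A functor $P\colon\mathcal C^{op}\to\mathbf{InfSL}$ (write $P_f$ for $P(f)$) is an elementary existential doctrine if: (Elementary) for every object $A$ there is $\delta_A\in P(A\times A)$ such that for every $X$ and $e=\mathrm{id}_X\times\Delta_A\colon X\times A\to X\times A\times A$, the map $P_e$ has a left adjoint $\exists_e$ given by $\exists_e(\alpha)=P_{\langle\pi_1,\pi_2\rangle}(\alpha)\wedge P_{\langle\pi_2,\pi_3\rangle}(\delta_A)$; (Existential) for every projection $\pi_i\colon A_1\times A_2\to A_i$, $P_{\pi_i}$ has a left adjoint $\exists_{\pi_i}$ such that (Beck–Chevalley)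 for any projection $\pi\colon X\times A\to A$ and any pullback square with $f'\colon X'\to X\times A$, $\pi'\colon X'\to A'$, $f\colon A'\to A$, $\pi f'=f\pi'$, one has $\exists_{\pi'}(P_{f'}(\beta))=P_f(\exists_\pi(\beta))$ for all $\beta\in P(X\times A)$, and (Frobenius reciprocity) $\exists_\pi(P_\pi(\alpha)\wedge\beta)=\alpha\wedge\exists_\pi(\beta)$ for all $\alpha\in P(A)$, $\beta\in P(X\times A)$. *)

theory Defs
  imports "HOL-Algebra.Galois_Connection"
begin

section \<open>Categories\<close>

text \<open>Composition is diagrammatic: \<open>f \<Zsemi> g\<close> is first \<open>f\<close>, then \<open>g\<close>. Objects and arrows are
  the elements of carrier sets; the operations are constrained only on these.\<close>

record ('o, 'a) category =
  Obj :: "'o set"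
  Arr :: "'a set"
  Dom :: "'a \<Rightarrow> 'o"
  Cod :: "'a \<Rightarrow> 'o"
  Ide :: "'o \<Rightarrow> 'a"
  Comp :: "'a \<Rightarrow> 'a \<Rightarrow> 'a" (infixl \<open>\<Zsemi>\<index>\<close> 65)

definition Hom :: "('o, 'a, 'z) category_scheme \<Rightarrow> 'o \<Rightarrow> 'o \<Rightarrow> 'a set" where
  "Hom C X Y = {f \<in> Arr C. Dom C f = X \<and> Cod C f = Y}"

locale category =
  fixes C (structure)
  assumes Dom_Obj: "f \<in> Arr C \<Longrightarrow> Dom C f \<in> Obj C"
    and Cod_Obj: "f \<in> Arr C \<Longrightarrow> Cod C f \<in> Obj C"
    and Ide_Hom: "X \<in> Obj C \<Longrightarrow> Ide C X \<in> Hom C X X"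
    and Comp_Hom: "\<lbrakk>f \<in> Hom C X Y; g \<in> Hom C Y Z\<rbrakk> \<Longrightarrow> f \<Zsemi> g \<in> Hom C X Z"
    and Ide_left: "f \<in> Hom C X Y \<Longrightarrow> Ide C X \<Zsemi> f = f"
    and Ide_right: "f \<in> Hom C X Y \<Longrightarrow> f \<Zsemi> Ide C Y = f"
    and Comp_assoc: "\<lbrakk>f \<in> Hom C W X; g \<in> Hom C X Y; h \<in> Hom C Y Z\<rbrakk>
      \<Longrightarrow> (f \<Zsemi> g) \<Zsemi> h = f \<Zsemi> (g \<Zsemi> h)"

definition inverse_arrows :: "('o, 'a, 'z) category_scheme \<Rightarrow> 'a \<Rightarrow> 'a \<Rightarrow> bool" where
  "inverse_arrows C f g \<longleftrightarrow> f \<in> Arr C \<and> g \<in> Hom C (Cod C f) (Dom C f)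
    \<and> f \<Zsemi>\<^bsub>C\<^esub> g = Ide C (Dom C f) \<and> g \<Zsemi>\<^bsub>C\<^esub> f = Ide C (Cod C f)"

definition iso_arrow :: "('o, 'a, 'z) category_scheme \<Rightarrow> 'a \<Rightarrow> bool" where
  "iso_arrow C f \<longleftrightarrow> (\<exists>g. inverse_arrows C f g)"

definition inv_arrow :: "('o, 'a, 'z) category_scheme \<Rightarrow> 'a \<Rightarrow> 'a" where
  "inv_arrow C f = (THE g. inverse_arrows C f g)"

definition pullback :: "('o, 'a, 'z) category_scheme \<Rightarrow> 'a \<Rightarrow> 'a \<Rightarrow> 'a \<Rightarrow> 'a \<Rightarrow> bool" where
  \<comment> \<open>the square \<open>f' \<Zsemi> p = p' \<Zsemi> f\<close> is a pullback\<close>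
  "pullback C f' p' p f \<longleftrightarrow>
     {f', p', p, f} \<subseteq> Arr C \<and> Dom C f' = Dom C p' \<and> Cod C f' = Dom C p \<and>
     Cod C p' = Dom C f \<and> Cod C p = Cod C f \<and> f' \<Zsemi>\<^bsub>C\<^esub> p = p' \<Zsemi>\<^bsub>C\<^esub> f \<and>
     (\<forall>T \<in> Obj C. \<forall>h \<in> Hom C T (Dom C p). \<forall>k \<in> Hom C T (Dom C f).
        h \<Zsemi>\<^bsub>C\<^esub> p = k \<Zsemi>\<^bsub>C\<^esub> f \<longrightarrow>
        (\<exists>!u. u \<in> Hom C T (Dom C f') \<and> u \<Zsemi>\<^bsub>C\<^esub> f' = h \<and> u \<Zsemi>\<^bsub>C\<^esub> p' = k))"


section \<open>Cartesian categories\<close>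

record ('o, 'a) cartesian_category = "('o, 'a) category" +
  Prod :: "'o \<Rightarrow> 'o \<Rightarrow> 'o" (infixr \<open>\<Otimes>\<index>\<close> 70)
  Fst :: "'o \<Rightarrow> 'o \<Rightarrow> 'a"
  Snd :: "'o \<Rightarrow> 'o \<Rightarrow> 'a"
  One :: "'o"

locale cartesian_category = category C for C (structure) +
  assumes Prod_Obj: "\<lbrakk>A \<in> Obj C; B \<in> Obj C\<rbrakk> \<Longrightarrow> A \<Otimes> B \<in> Obj C"
    and Fst_Hom: "\<lbrakk>A \<in> Obj C; B \<in> Obj C\<rbrakk> \<Longrightarrow> Fst C A B \<in> Hom C (A \<Otimes> B) A"
    and Snd_Hom: "\<lbrakk>A \<in> Obj C; B \<in> Obj C\<rbrakk> \<Longrightarrow> Snd C A B \<in> Hom C (A \<Otimes> B) B"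
    and Prod_universal: "\<lbrakk>A \<in> Obj C; B \<in> Obj C; f \<in> Hom C X A; g \<in> Hom C X B\<rbrakk>
      \<Longrightarrow> \<exists>!h. h \<in> Hom C X (A \<Otimes> B) \<and> h \<Zsemi> Fst C A B = f \<and> h \<Zsemi> Snd C A B = g"
    and One_Obj: "One C \<in> Obj C"
    and One_universal: "A \<in> Obj C \<Longrightarrow> \<exists>!t. t \<in> Hom C A (One C)"

definition pairing :: "('o, 'a, 'z) cartesian_category_scheme \<Rightarrow> 'a \<Rightarrow> 'a \<Rightarrow> 'a" where
  "pairing C f g = (THE h. h \<in> Hom C (Dom C f) (Cod C f \<Otimes>\<^bsub>C\<^esub> Cod C g) \<and>
     h \<Zsemi>\<^bsub>C\<^esub> Fst C (Cod C f) (Cod C g) = f \<and> h \<Zsemi>\<^bsub>C\<^esub> Snd C (Cod C f) (Cod C g) = g)"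

definition diagonal :: "('o, 'a, 'z) cartesian_category_scheme \<Rightarrow> 'o \<Rightarrow> 'a" where
  "diagonal C A = pairing C (Ide C A) (Ide C A)"

definition prod_arrow :: "('o, 'a, 'z) cartesian_category_scheme \<Rightarrow> 'a \<Rightarrow> 'a \<Rightarrow> 'a" where
  "prod_arrow C f g = pairing C (Fst C (Dom C f) (Dom C g) \<Zsemi>\<^bsub>C\<^esub> f) (Snd C (Dom C f) (Dom C g) \<Zsemi>\<^bsub>C\<^esub> g)"

definition projection :: "('o, 'a, 'z) cartesian_category_scheme \<Rightarrow> 'a \<Rightarrow> bool" where
  "projection C p \<longleftrightarrow> (\<exists>A \<in> Obj C. \<exists>B \<in> Obj C. p = Fst C A B \<or> p = Snd C A B)"


section \<open>Elementary existential doctrines\<close>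

text \<open>An object of \<open>InfSL\<close> is given by its order, which determines meets and top element.\<close>

definition InfSL_object :: "('s, 'z) gorder_scheme \<Rightarrow> bool" where
  "InfSL_object L \<longleftrightarrow> lower_semilattice L \<and> weak_partial_order_top L"

definition InfSL_hom :: "('s, 'y) gorder_scheme \<Rightarrow> ('t, 'z) gorder_scheme \<Rightarrow> ('s \<Rightarrow> 't) \<Rightarrow> bool" where
  "InfSL_hom L M h \<longleftrightarrow> h \<in> carrier L \<rightarrow> carrier M \<and> h \<top>\<^bsub>L\<^esub> = \<top>\<^bsub>M\<^esub> \<and>
     (\<forall>x \<in> carrier L. \<forall>y \<in> carrier L. h (x \<sqinter>\<^bsub>L\<^esub> y) = h x \<sqinter>\<^bsub>M\<^esub> h y)"

definition left_adjoint :: "('s, 'y) gorder_scheme \<Rightarrow> ('t, 'z) gorder_scheme \<Rightarrow>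
    ('s \<Rightarrow> 't) \<Rightarrow> ('t \<Rightarrow> 's) \<Rightarrow> bool" where
  "left_adjoint L M l u \<longleftrightarrow>
     galois_connection \<lparr>orderA = L, orderB = M, lower = l, upper = u\<rparr>"

text \<open>A functor from the opposite of \<open>C\<close> to \<open>InfSL\<close>, with object part \<open>P\<close> and arrow part \<open>R\<close>.
  Since functions are total, the functor laws are stated on carriers.\<close>

locale InfSL_functor = category C for C (structure) +
  fixes P :: "'o \<Rightarrow> 's gorder" and R :: "'a \<Rightarrow> 's \<Rightarrow> 's"
  assumes P_object: "A \<in> Obj C \<Longrightarrow> InfSL_object (P A)"
    and R_hom: "f \<in> Hom C A B \<Longrightarrow> InfSL_hom (P B) (P A) (R f)"
    and R_Ide: "\<lbrakk>A \<in> Obj C; \<alpha> \<in> carrier (P A)\<rbrakk> \<Longrightarrow> R (Ide C A) \<alpha> = \<alpha>"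
    and R_Comp: "\<lbrakk>f \<in> Hom C A B; g \<in> Hom C B D; \<alpha> \<in> carrier (P D)\<rbrakk>
      \<Longrightarrow> R (f \<Zsemi> g) \<alpha> = R f (R g \<alpha>)"

text \<open>In \<open>elementary\<close>, the triple product is bracketed \<open>X \<times> (A \<times> A)\<close>, so its three projections are
  \<open>Fst\<close>, \<open>Snd \<Zsemi> Fst\<close> and \<open>Snd \<Zsemi> Snd\<close>. In \<open>existential\<close>, the arrow \<open>p'\<close> opposite to the
  projection \<open>p\<close> in an arbitrary pullback square need not itself be a chosen projection, so the
  existence of a left adjoint of \<open>R p'\<close> is part of the Beck--Chevalley condition.\<close>

locale elementary_existential_doctrine =
  cartesian_category C + InfSL_functor C P R
  for C (structure) and P :: "'o \<Rightarrow> 's gorder" and R :: "'a \<Rightarrow> 's \<Rightarrow> 's" +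
  assumes elementary: "A \<in> Obj C \<Longrightarrow>
    \<exists>\<delta> \<in> carrier (P (A \<Otimes> A)). \<forall>X \<in> Obj C.
      let \<pi>\<^sub>1 = Fst C X (A \<Otimes> A);
          \<pi>\<^sub>2 = Snd C X (A \<Otimes> A) \<Zsemi> Fst C A A;
          \<pi>\<^sub>3 = Snd C X (A \<Otimes> A) \<Zsemi> Snd C A A;
          e = prod_arrow C (Ide C X) (diagonal C A)
      in left_adjoint (P (X \<Otimes> A)) (P (X \<Otimes> (A \<Otimes> A)))
           (\<lambda>\<alpha>. R (pairing C \<pi>\<^sub>1 \<pi>\<^sub>2) \<alpha> \<sqinter>\<^bsub>P (X \<Otimes> (A \<Otimes> A))\<^esub> R (pairing C \<pi>\<^sub>2 \<pi>\<^sub>3) \<delta>)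
           (R e)"
  and existential: "projection C p \<Longrightarrow>
    \<exists>ex. left_adjoint (P (Dom C p)) (P (Cod C p)) ex (R p) \<and>
      (\<forall>f' p' f. pullback C f' p' p f \<longrightarrow>
         (\<exists>ex'. left_adjoint (P (Dom C p')) (P (Cod C p')) ex' (R p') \<and>
            (\<forall>\<beta> \<in> carrier (P (Dom C p)). ex' (R f' \<beta>) = R f (ex \<beta>)))) \<and>
      (\<forall>\<alpha> \<in> carrier (P (Cod C p)). \<forall>\<beta> \<in> carrier (P (Dom C p)).
         ex (R p \<alpha> \<sqinter>\<^bsub>P (Dom C p)\<^esub> \<beta>) = \<alpha> \<sqinter>\<^bsub>P (Cod C p)\<^esub> ex \<beta>)"


section \<open>Symmetric monoidal categories\<close>

text \<open>The tensor is written \<open>\<odot>\<close> on objects and \<open>\<otimes>\<close> on arrows.\<close>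

record ('o, 'a) symmetric_monoidal_category = "('o, 'a) category" +
  TensorO :: "'o \<Rightarrow> 'o \<Rightarrow> 'o" (infixl \<open>\<odot>\<index>\<close> 70)
  Tensor :: "'a \<Rightarrow> 'a \<Rightarrow> 'a" (infixl \<open>\<otimes>\<index>\<close> 70)
  Unit :: "'o"
  Assoc :: "'o \<Rightarrow> 'o \<Rightarrow> 'o \<Rightarrow> 'a"
  Lunit :: "'o \<Rightarrow> 'a"
  Runit :: "'o \<Rightarrow> 'a"
  Sym :: "'o \<Rightarrow> 'o \<Rightarrow> 'a"

locale symmetric_monoidal_category = category B for B (structure) +
  assumes Unit_Obj: "Unit B \<in> Obj B"
    and TensorO_Obj: "\<lbrakk>X \<in> Obj B; Y \<in> Obj B\<rbrakk> \<Longrightarrow> X \<odot> Y \<in> Obj B"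
    and Tensor_Hom: "\<lbrakk>f \<in> Hom B X X'; g \<in> Hom B Y Y'\<rbrakk> \<Longrightarrow> f \<otimes> g \<in> Hom B (X \<odot> Y) (X' \<odot> Y')"
    and Tensor_Ide: "\<lbrakk>X \<in> Obj B; Y \<in> Obj B\<rbrakk> \<Longrightarrow> Ide B X \<otimes> Ide B Y = Ide B (X \<odot> Y)"
    and Tensor_Comp: "\<lbrakk>f \<in> Hom B X X'; f' \<in> Hom B X' X''; g \<in> Hom B Y Y'; g' \<in> Hom B Y' Y''\<rbrakk>
      \<Longrightarrow> (f \<Zsemi> f') \<otimes> (g \<Zsemi> g') = (f \<otimes> g) \<Zsemi> (f' \<otimes> g')"
    and Assoc_Hom: "\<lbrakk>X \<in> Obj B; Y \<in> Obj B; Z \<in> Obj B\<rbrakk>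
      \<Longrightarrow> Assoc B X Y Z \<in> Hom B ((X \<odot> Y) \<odot> Z) (X \<odot> (Y \<odot> Z))"
    and Assoc_iso: "\<lbrakk>X \<in> Obj B; Y \<in> Obj B; Z \<in> Obj B\<rbrakk> \<Longrightarrow> iso_arrow B (Assoc B X Y Z)"
    and Assoc_natural: "\<lbrakk>f \<in> Hom B X X'; g \<in> Hom B Y Y'; h \<in> Hom B Z Z'\<rbrakk>
      \<Longrightarrow> ((f \<otimes> g) \<otimes> h) \<Zsemi> Assoc B X' Y' Z' = Assoc B X Y Z \<Zsemi> (f \<otimes> (g \<otimes> h))"
    and Lunit_Hom: "X \<in> Obj B \<Longrightarrow> Lunit B X \<in> Hom B (Unit B \<odot> X) X"
    and Lunit_iso: "X \<in> Obj B \<Longrightarrow> iso_arrow B (Lunit B X)"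
    and Lunit_natural: "f \<in> Hom B X Y \<Longrightarrow> (Ide B (Unit B) \<otimes> f) \<Zsemi> Lunit B Y = Lunit B X \<Zsemi> f"
    and Runit_Hom: "X \<in> Obj B \<Longrightarrow> Runit B X \<in> Hom B (X \<odot> Unit B) X"
    and Runit_iso: "X \<in> Obj B \<Longrightarrow> iso_arrow B (Runit B X)"
    and Runit_natural: "f \<in> Hom B X Y \<Longrightarrow> (f \<otimes> Ide B (Unit B)) \<Zsemi> Runit B Y = Runit B X \<Zsemi> f"
    and Sym_Hom: "\<lbrakk>X \<in> Obj B; Y \<in> Obj B\<rbrakk> \<Longrightarrow> Sym B X Y \<in> Hom B (X \<odot> Y) (Y \<odot> X)"
    and Sym_natural: "\<lbrakk>f \<in> Hom B X X'; g \<in> Hom B Y Y'\<rbrakk>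
      \<Longrightarrow> (f \<otimes> g) \<Zsemi> Sym B X' Y' = Sym B X Y \<Zsemi> (g \<otimes> f)"
    and Sym_inverse: "\<lbrakk>X \<in> Obj B; Y \<in> Obj B\<rbrakk> \<Longrightarrow> Sym B X Y \<Zsemi> Sym B Y X = Ide B (X \<odot> Y)"
    and triangle: "\<lbrakk>X \<in> Obj B; Y \<in> Obj B\<rbrakk>
      \<Longrightarrow> Assoc B X (Unit B) Y \<Zsemi> (Ide B X \<otimes> Lunit B Y) = Runit B X \<otimes> Ide B Y"
    and pentagon: "\<lbrakk>W \<in> Obj B; X \<in> Obj B; Y \<in> Obj B; Z \<in> Obj B\<rbrakk>
      \<Longrightarrow> (Assoc B W X Y \<otimes> Ide B Z) \<Zsemi> Assoc B W (X \<odot> Y) Z \<Zsemi> (Ide B W \<otimes> Assoc B X Y Z)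
        = Assoc B (W \<odot> X) Y Z \<Zsemi> Assoc B W X (Y \<odot> Z)"
    and hexagon: "\<lbrakk>X \<in> Obj B; Y \<in> Obj B; Z \<in> Obj B\<rbrakk>
      \<Longrightarrow> Assoc B X Y Z \<Zsemi> Sym B X (Y \<odot> Z) \<Zsemi> Assoc B Y Z X
        = (Sym B X Y \<otimes> Ide B Z) \<Zsemi> Assoc B Y X Z \<Zsemi> (Ide B Y \<otimes> Sym B X Z)"

text \<open>The interchange \<open>(X \<odot> X) \<odot> (Y \<odot> Y) \<rightarrow> (X \<odot> Y) \<odot> (X \<odot> Y)\<close>, which is
  \<open>id \<otimes> Sym X Y \<otimes> id\<close> up to associativity.\<close>

definition interchange :: "('o, 'a, 'z) symmetric_monoidal_category_scheme \<Rightarrow> 'o \<Rightarrow> 'o \<Rightarrow> 'a" where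
  "interchange B X Y =
     Assoc B X X (Y \<odot>\<^bsub>B\<^esub> Y)
     \<Zsemi>\<^bsub>B\<^esub> (Ide B X \<otimes>\<^bsub>B\<^esub>
           (inv_arrow B (Assoc B X Y Y) \<Zsemi>\<^bsub>B\<^esub> (Sym B X Y \<otimes>\<^bsub>B\<^esub> Ide B Y) \<Zsemi>\<^bsub>B\<^esub> Assoc B Y X Y))
     \<Zsemi>\<^bsub>B\<^esub> inv_arrow B (Assoc B X Y (X \<odot>\<^bsub>B\<^esub> Y))"


section \<open>Cartesian bicategories\<close>

record ('o, 'a) cartesian_bicategory = "('o, 'a) symmetric_monoidal_category" +
  Leq :: "'a \<Rightarrow> 'a \<Rightarrow> bool" (infix \<open>\<preceq>\<index>\<close> 50)
  Dup :: "'o \<Rightarrow> 'a"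
  Del :: "'o \<Rightarrow> 'a"

definition Hom_order :: "('o, 'a, 'z) cartesian_bicategory_scheme \<Rightarrow> 'o \<Rightarrow> 'o \<Rightarrow> 'a gorder" where
  "Hom_order B X Y = \<lparr>carrier = Hom B X Y, eq = (=), le = (\<preceq>\<^bsub>B\<^esub>)\<rparr>"

definition right_adjoint_arrow ::
    "('o, 'a, 'z) cartesian_bicategory_scheme \<Rightarrow> 'a \<Rightarrow> 'a \<Rightarrow> bool" where
  \<comment> \<open>\<open>r\<close> is a right adjoint of \<open>f\<close>\<close>
  "right_adjoint_arrow B f r \<longleftrightarrow> f \<in> Arr B \<and> r \<in> Hom B (Cod B f) (Dom B f) \<and>
     Ide B (Dom B f) \<preceq>\<^bsub>B\<^esub> f \<Zsemi>\<^bsub>B\<^esub> r \<and> r \<Zsemi>\<^bsub>B\<^esub> f \<preceq>\<^bsub>B\<^esub> Ide B (Cod B f)"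

text \<open>Right adjoints are unique, so \<open>frobenius\<close> speaks about the right adjoint of \<open>Dup\<close>.\<close>

locale cartesian_bicategory = symmetric_monoidal_category B for B (structure) +
  assumes Hom_poset: "\<lbrakk>X \<in> Obj B; Y \<in> Obj B\<rbrakk> \<Longrightarrow> partial_order (Hom_order B X Y)"
    and Comp_mono: "\<lbrakk>f \<in> Hom B X Y; f' \<in> Hom B X Y; g \<in> Hom B Y Z; g' \<in> Hom B Y Z;
        f \<preceq> f'; g \<preceq> g'\<rbrakk> \<Longrightarrow> f \<Zsemi> g \<preceq> f' \<Zsemi> g'"
    and Tensor_mono: "\<lbrakk>f \<in> Hom B X Y; f' \<in> Hom B X Y; g \<in> Hom B V W; g' \<in> Hom B V W;
        f \<preceq> f'; g \<preceq> g'\<rbrakk> \<Longrightarrow> f \<otimes> g \<preceq> f' \<otimes> g'"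
    \<comment> \<open>cocommutative comonoids\<close>
    and Dup_Hom: "X \<in> Obj B \<Longrightarrow> Dup B X \<in> Hom B X (X \<odot> X)"
    and Del_Hom: "X \<in> Obj B \<Longrightarrow> Del B X \<in> Hom B X (Unit B)"
    and Dup_coassoc: "X \<in> Obj B \<Longrightarrow>
      Dup B X \<Zsemi> (Dup B X \<otimes> Ide B X) \<Zsemi> Assoc B X X X = Dup B X \<Zsemi> (Ide B X \<otimes> Dup B X)"
    and Dup_Del_left: "X \<in> Obj B \<Longrightarrow> Dup B X \<Zsemi> (Del B X \<otimes> Ide B X) \<Zsemi> Lunit B X = Ide B X"
    and Dup_Del_right: "X \<in> Obj B \<Longrightarrow> Dup B X \<Zsemi> (Ide B X \<otimes> Del B X) \<Zsemi> Runit B X = Ide B X"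
    and Dup_cocomm: "X \<in> Obj B \<Longrightarrow> Dup B X \<Zsemi> Sym B X X = Dup B X"
    \<comment> \<open>right adjoints and the Frobenius law\<close>
    and Dup_adjoint: "X \<in> Obj B \<Longrightarrow> \<exists>r. right_adjoint_arrow B (Dup B X) r"
    and Del_adjoint: "X \<in> Obj B \<Longrightarrow> \<exists>r. right_adjoint_arrow B (Del B X) r"
    and frobenius: "\<lbrakk>X \<in> Obj B; right_adjoint_arrow B (Dup B X) r\<rbrakk> \<Longrightarrow>
      (Dup B X \<otimes> Ide B X) \<Zsemi> Assoc B X X X \<Zsemi> (Ide B X \<otimes> r) = r \<Zsemi> Dup B X"
    \<comment> \<open>all arrows are lax comonoid homomorphisms\<close>
    and Dup_lax: "f \<in> Hom B X Y \<Longrightarrow> f \<Zsemi> Dup B Y \<preceq> Dup B X \<Zsemi> (f \<otimes> f)"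
    and Del_lax: "f \<in> Hom B X Y \<Longrightarrow> f \<Zsemi> Del B Y \<preceq> Del B X"
    \<comment> \<open>coherence of the comonoids with the monoidal structure\<close>
    and Del_Tensor: "\<lbrakk>X \<in> Obj B; Y \<in> Obj B\<rbrakk>
      \<Longrightarrow> Del B (X \<odot> Y) = (Del B X \<otimes> Del B Y) \<Zsemi> Lunit B (Unit B)"
    and Dup_Tensor: "\<lbrakk>X \<in> Obj B; Y \<in> Obj B\<rbrakk>
      \<Longrightarrow> Dup B (X \<odot> Y) = (Dup B X \<otimes> Dup B Y) \<Zsemi> interchange B X Y"
    and Dup_Unit: "Dup B (Unit B) = inv_arrow B (Lunit B (Unit B))"
    and Del_Unit: "Del B (Unit B) = Ide B (Unit B)"

definition map_arrow :: "('o, 'a, 'z) cartesian_bicategory_scheme \<Rightarrow> 'a \<Rightarrow> bool" where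
  "map_arrow B f \<longleftrightarrow> f \<in> Arr B \<and>
     f \<Zsemi>\<^bsub>B\<^esub> Dup B (Cod B f) = Dup B (Dom B f) \<Zsemi>\<^bsub>B\<^esub> (f \<otimes>\<^bsub>B\<^esub> f) \<and>
     f \<Zsemi>\<^bsub>B\<^esub> Del B (Cod B f) = Del B (Dom B f)"

text \<open>The projections discard the other factor; pairings, diagonals and terminal arrows are then
  determined by the universal properties.\<close>

definition Map_category ::
    "('o, 'a, 'z) cartesian_bicategory_scheme \<Rightarrow> ('o, 'a) cartesian_category" where
  "Map_category B = \<lparr>
     Obj = Obj B,
     Arr = {f. map_arrow B f},
     Dom = Dom B,
     Cod = Cod B,
     Ide = Ide B,
     Comp = Comp B,
     Prod = TensorO B,
     Fst = (\<lambda>X Y. (Ide B X \<otimes>\<^bsub>B\<^esub> Del B Y) \<Zsemi>\<^bsub>B\<^esub> Runit B X),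
     Snd = (\<lambda>X Y. (Del B X \<otimes>\<^bsub>B\<^esub> Ide B Y) \<Zsemi>\<^bsub>B\<^esub> Lunit B Y),
     One = Unit B\<rparr>"

text \<open>The functor \<open>Hom(-, I)\<close>: the object part is \<open>Hom(X, I)\<close> with the order of \<open>B\<close>, the
  arrow part is precomposition.\<close>

definition Hom_functor_obj ::
    "('o, 'a, 'z) cartesian_bicategory_scheme \<Rightarrow> 'o \<Rightarrow> 'a gorder" where
  "Hom_functor_obj B X = Hom_order B X (Unit B)"

definition Hom_functor_arr ::
    "('o, 'a, 'z) cartesian_bicategory_scheme \<Rightarrow> 'a \<Rightarrow> 'a \<Rightarrow> 'a" where
  "Hom_functor_arr B f = (\<lambda>U. f \<Zsemi>\<^bsub>B\<^esub> U)"

end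

theory Submission
  imports Defs
begin

text \<open>
  An arrow with a right adjoint is a map, so coherence isomorphisms, \<open>Dup\<close>, \<open>Del\<close> and projections are
  maps, and equations between maps into a tensor product may be checked on the two projections.
  The left adjoint of precomposition with a map \<open>f\<close> is precomposition with its right adjoint \<open>f*\<close>.
  For equality one takes \<open>\<delta> = d*; e\<close>: the Frobenius law says that restricting along \<open>\<delta>\<close> and then projecting is
  \<open>id \<otimes> d*\<close>. For projections, \<open>f*\<close> is \<open>id \<otimes> e*\<close> up to a unit isomorphism; it commutes with reindexing of
  the other factor, which gives Beck--Chevalley, and with the graph \<open>\<langle>f, id\<rangle>\<close>, which is
  \<open>d \<otimes> id\<close> up to an associator; this gives Frobenius reciprocity.
\<close>

section \<open>Categories and symmetric monoidal categories\<close>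

text \<open>The tensor is not strict, so each step that is immediate in string diagrams meets
  associators and unitors. Checking on projections disposes of them, but only between maps, and the
  right adjoints of \<open>Dup\<close> and \<open>Del\<close> are in general not maps. Equations
  with such an adjoint are therefore split: the part built from maps (a graph, a reordering of
  factors) is settled on projections, and the adjoint is moved past it by naturality or by the
  Frobenius law. Two coherence facts must come from elsewhere, because the projection rules for the
  associator rest on them: the triangle and Kelly's law \<open>Lunit_Tensor\<close>. Origin of
  \<delta>: read relationally, the right adjoint of \<open>Dup A\<close> relates (a, b) to c when a
  = b = c; \<open>Del A\<close> forgets c and leaves the predicate a = b. The meets of the doctrine
  are given by the order alone. Diagrammatic arguments reach them only after they are identified
  with the composite \<open>Hom_meet\<close>.\<close>

context category
begin

lemma Hom_iff: "f \<in> Hom C X Y \<longleftrightarrow> f \<in> Arr C \<and> Dom C f = X \<and> Cod C f = Y"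
  by (auto simp: Hom_def)

lemma Ide_simps [simp]:
  assumes "X \<in> Obj C"
  shows "Ide C X \<in> Arr C" "Dom C (Ide C X) = X" "Cod C (Ide C X) = X"
  using Ide_Hom[OF assms] by (auto simp: Hom_iff)

lemma Dom_Cod_Obj [simp]: "f \<in> Arr C \<Longrightarrow> Dom C f \<in> Obj C" "f \<in> Arr C \<Longrightarrow> Cod C f \<in> Obj C"
  by (simp_all add: Dom_Obj Cod_Obj)

lemma Comp_simps [simp]:
  assumes "f \<in> Arr C" "g \<in> Arr C" "Cod C f = Dom C g"
  shows "f \<Zsemi> g \<in> Arr C" "Dom C (f \<Zsemi> g) = Dom C f" "Cod C (f \<Zsemi> g) = Cod C g"
  using Comp_Hom[of f "Dom C f" "Dom C g" g "Cod C g"] assms by (auto simp: Hom_iff)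

lemma Ide_Comp [simp]: "\<lbrakk>f \<in> Arr C; Dom C f = X\<rbrakk> \<Longrightarrow> Ide C X \<Zsemi> f = f"
  using Ide_left[of f "Dom C f" "Cod C f"] by (auto simp: Hom_iff)

lemma Comp_Ide [simp]: "\<lbrakk>f \<in> Arr C; Cod C f = Y\<rbrakk> \<Longrightarrow> f \<Zsemi> Ide C Y = f"
  using Ide_right[of f "Dom C f" "Cod C f"] by (auto simp: Hom_iff)

lemma Comp_assoc_simp [simp]:
  "\<lbrakk>f \<in> Arr C; g \<in> Arr C; h \<in> Arr C; Cod C f = Dom C g; Cod C g = Dom C h\<rbrakk>
    \<Longrightarrow> (f \<Zsemi> g) \<Zsemi> h = f \<Zsemi> (g \<Zsemi> h)"
  using Comp_assoc by (simp add: Hom_iff)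

text \<open>Composites are kept nested to the right, where an equation about
  \<open>f \<Zsemi> g\<close> no longer matches; this is its form at the head of a longer
  composite.\<close>

lemma Comp_reassoc:
  "\<lbrakk>f \<Zsemi> g = k; f \<in> Arr C; g \<in> Arr C; h \<in> Arr C; Cod C f = Dom C g; Cod C g = Dom C h\<rbrakk>
    \<Longrightarrow> f \<Zsemi> (g \<Zsemi> h) = k \<Zsemi> h"
  by (metis Comp_assoc_simp)

lemma inverse_arrows_unique:
  assumes "inverse_arrows C f g" "inverse_arrows C f h"
  shows "g = h"
proof -
  have arr: "f \<in> Arr C" "g \<in> Arr C" "h \<in> Arr C" "Dom C g = Cod C f" "Cod C g = Dom C f"
    "Dom C h = Cod C f" "Cod C h = Dom C f" and eqs: "g \<Zsemi> f = Ide C (Cod C f)" "f \<Zsemi> h = Ide C (Dom C f)"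
    using assms by (simp_all add: inverse_arrows_def Hom_iff)
  have "g = g \<Zsemi> (f \<Zsemi> h)" using arr eqs(2) by simp
  also have "\<dots> = h" using arr by (simp add: Comp_reassoc[OF eqs(1)])
  finally show ?thesis .
qed

lemma inverse_arrows_inv_arrow: "iso_arrow C f \<Longrightarrow> inverse_arrows C f (inv_arrow C f)"
  unfolding iso_arrow_def inv_arrow_def by (metis inverse_arrows_unique theI)

lemma iso_arrow_simps:
  assumes "iso_arrow C f"
  shows "inv_arrow C f \<in> Arr C" "Dom C (inv_arrow C f) = Cod C f" "Cod C (inv_arrow C f) = Dom C f"
    "f \<Zsemi> inv_arrow C f = Ide C (Dom C f)" "inv_arrow C f \<Zsemi> f = Ide C (Cod C f)"
    "\<lbrakk>k \<in> Arr C; Dom C k = Dom C f\<rbrakk> \<Longrightarrow> f \<Zsemi> (inv_arrow C f \<Zsemi> k) = k"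
    "\<lbrakk>k \<in> Arr C; Dom C k = Cod C f\<rbrakk> \<Longrightarrow> inv_arrow C f \<Zsemi> (f \<Zsemi> k) = k"
proof -
  have *: "inverse_arrows C f (inv_arrow C f)" using assms by (rule inverse_arrows_inv_arrow)
  then have f: "f \<in> Arr C" by (simp add: inverse_arrows_def)
  show 1: "inv_arrow C f \<in> Arr C" "Dom C (inv_arrow C f) = Cod C f" "Cod C (inv_arrow C f) = Dom C f"
    "f \<Zsemi> inv_arrow C f = Ide C (Dom C f)" "inv_arrow C f \<Zsemi> f = Ide C (Cod C f)"
    using * by (auto simp: inverse_arrows_def Hom_iff)
  show "\<lbrakk>k \<in> Arr C; Dom C k = Dom C f\<rbrakk> \<Longrightarrow> f \<Zsemi> (inv_arrow C f \<Zsemi> k) = k"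
    using f 1 Comp_reassoc[OF 1(4)] by simp
  show "\<lbrakk>k \<in> Arr C; Dom C k = Cod C f\<rbrakk> \<Longrightarrow> inv_arrow C f \<Zsemi> (f \<Zsemi> k) = k"
    using f 1 Comp_reassoc[OF 1(5)] by simp
qed

lemma iso_arrow_Comp_cancel:
  assumes "iso_arrow C f" "f \<Zsemi> g = f \<Zsemi> h" "f \<in> Arr C" "g \<in> Arr C" "h \<in> Arr C"
    "Dom C g = Cod C f" "Dom C h = Cod C f"
  shows "g = h"
  using assms by (metis iso_arrow_simps(7))

end

section \<open>Calculating with associators, unitors and the symmetry\<close>

context symmetric_monoidal_category
begin

declare Unit_Obj [simp] TensorO_Obj [simp] Tensor_Ide [simp]

lemma Tensor_simps [simp]:
  assumes "f \<in> Arr B" "g \<in> Arr B"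
  shows "f \<otimes> g \<in> Arr B" "Dom B (f \<otimes> g) = Dom B f \<odot> Dom B g" "Cod B (f \<otimes> g) = Cod B f \<odot> Cod B g"
  using Tensor_Hom[of f "Dom B f" "Cod B f" g "Dom B g" "Cod B g"] assms by (auto simp: Hom_iff)

text \<open>Two tensors in a row are always merged; a calculation that needs them apart states the
  split form as an intermediate line.\<close>

lemma Comp_Tensor [simp]:
  assumes "f \<in> Arr B" "f' \<in> Arr B" "g \<in> Arr B" "g' \<in> Arr B" "Cod B f = Dom B f'" "Cod B g = Dom B g'"
  shows "(f \<otimes> g) \<Zsemi> (f' \<otimes> g') = (f \<Zsemi> f') \<otimes> (g \<Zsemi> g')"
  using Tensor_Comp assms by (simp add: Hom_iff)

lemma Comp_Tensor_Comp [simp]: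
  assumes "f \<in> Arr B" "f' \<in> Arr B" "g \<in> Arr B" "g' \<in> Arr B" "Cod B f = Dom B f'" "Cod B g = Dom B g'"
    "k \<in> Arr B" "Dom B k = Cod B f' \<odot> Cod B g'"
  shows "(f \<otimes> g) \<Zsemi> ((f' \<otimes> g') \<Zsemi> k) = ((f \<Zsemi> f') \<otimes> (g \<Zsemi> g')) \<Zsemi> k"
  using Comp_reassoc[OF Comp_Tensor] assms by simp

lemma Assoc_simps [simp]:
  assumes "X \<in> Obj B" "Y \<in> Obj B" "Z \<in> Obj B"
  shows "Assoc B X Y Z \<in> Arr B" "Dom B (Assoc B X Y Z) = (X \<odot> Y) \<odot> Z"
    "Cod B (Assoc B X Y Z) = X \<odot> (Y \<odot> Z)"
  using Assoc_Hom[OF assms] by (auto simp: Hom_iff)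

lemmas inv_Assoc_simps [simp] = iso_arrow_simps[OF Assoc_iso, simplified]

lemma Lunit_simps [simp]:
  assumes "X \<in> Obj B"
  shows "Lunit B X \<in> Arr B" "Dom B (Lunit B X) = Unit B \<odot> X" "Cod B (Lunit B X) = X"
  using Lunit_Hom[OF assms] by (auto simp: Hom_iff)

lemmas inv_Lunit_simps [simp] = iso_arrow_simps[OF Lunit_iso, simplified]

lemma Runit_simps [simp]:
  assumes "X \<in> Obj B"
  shows "Runit B X \<in> Arr B" "Dom B (Runit B X) = X \<odot> Unit B" "Cod B (Runit B X) = X"
  using Runit_Hom[OF assms] by (auto simp: Hom_iff)

lemmas inv_Runit_simps [simp] = iso_arrow_simps[OF Runit_iso, simplified]

lemma Sym_simps [simp]:
  assumes "X \<in> Obj B" "Y \<in> Obj B"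
  shows "Sym B X Y \<in> Arr B" "Dom B (Sym B X Y) = X \<odot> Y" "Cod B (Sym B X Y) = Y \<odot> X"
  using Sym_Hom[OF assms] by (auto simp: Hom_iff)

lemma Assoc_nat:
  assumes "f \<in> Arr B" "g \<in> Arr B" "h \<in> Arr B"
  shows "((f \<otimes> g) \<otimes> h) \<Zsemi> Assoc B (Cod B f) (Cod B g) (Cod B h)
    = Assoc B (Dom B f) (Dom B g) (Dom B h) \<Zsemi> (f \<otimes> (g \<otimes> h))"
  by (rule Assoc_natural) (simp_all add: Hom_iff assms)

lemma inv_Assoc_nat:
  assumes "f \<in> Arr B" "g \<in> Arr B" "h \<in> Arr B"
  shows "(f \<otimes> (g \<otimes> h)) \<Zsemi> inv_arrow B (Assoc B (Cod B f) (Cod B g) (Cod B h))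
    = inv_arrow B (Assoc B (Dom B f) (Dom B g) (Dom B h)) \<Zsemi> ((f \<otimes> g) \<otimes> h)"
proof (rule iso_arrow_Comp_cancel[OF Assoc_iso])
  show "Assoc B (Dom B f) (Dom B g) (Dom B h) \<Zsemi>
      ((f \<otimes> (g \<otimes> h)) \<Zsemi> inv_arrow B (Assoc B (Cod B f) (Cod B g) (Cod B h)))
    = Assoc B (Dom B f) (Dom B g) (Dom B h) \<Zsemi>
      (inv_arrow B (Assoc B (Dom B f) (Dom B g) (Dom B h)) \<Zsemi> ((f \<otimes> g) \<otimes> h))"
    using assms by (simp add: Comp_reassoc[OF Assoc_nat[symmetric]])
qed (use assms in simp_all)

lemma Lunit_nat: "f \<in> Arr B \<Longrightarrow> (Ide B (Unit B) \<otimes> f) \<Zsemi> Lunit B (Cod B f) = Lunit B (Dom B f) \<Zsemi> f"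
  using Lunit_natural by (simp add: Hom_iff)

lemma Runit_nat: "f \<in> Arr B \<Longrightarrow> (f \<otimes> Ide B (Unit B)) \<Zsemi> Runit B (Cod B f) = Runit B (Dom B f) \<Zsemi> f"
  using Runit_natural by (simp add: Hom_iff)

lemma inv_Lunit_nat:
  assumes "f \<in> Arr B"
  shows "f \<Zsemi> inv_arrow B (Lunit B (Cod B f)) = inv_arrow B (Lunit B (Dom B f)) \<Zsemi> (Ide B (Unit B) \<otimes> f)"
  by (rule iso_arrow_Comp_cancel[OF Lunit_iso[of "Dom B f"]])
    (use assms in \<open>simp_all add: Comp_reassoc[OF Lunit_nat[symmetric]]\<close>)

lemma inv_Runit_nat:
  assumes "f \<in> Arr B"
  shows "f \<Zsemi> inv_arrow B (Runit B (Cod B f)) = inv_arrow B (Runit B (Dom B f)) \<Zsemi> (f \<otimes> Ide B (Unit B))"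
  by (rule iso_arrow_Comp_cancel[OF Runit_iso[of "Dom B f"]])
    (use assms in \<open>simp_all add: Comp_reassoc[OF Runit_nat[symmetric]]\<close>)

text \<open>\<open>Lunit\<close> is a natural isomorphism from tensoring with the unit to the
  identity: each arrow preceded by \<open>Lunit\<close> is its tensored version followed by
  \<open>Lunit\<close>, and \<open>Lunit\<close> cancels.\<close>

lemma Tensor_Unit_faithful:
  assumes "Ide B (Unit B) \<otimes> f = Ide B (Unit B) \<otimes> g" "f \<in> Arr B" "g \<in> Arr B"
    "Dom B f = Dom B g" "Cod B f = Cod B g"
  shows "f = g"
  by (rule iso_arrow_Comp_cancel[OF Lunit_iso[of "Dom B f"]])
    (use assms in \<open>simp_all add: Lunit_nat[of f, symmetric] Lunit_nat[of g, symmetric, simplified]\<close>,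
     metis Lunit_nat)

text \<open>Kelly's coherence law. Tensoring with the unit is faithful, and after it the law is the pentagon
  on \<open>I, I, X, Y\<close> combined with two triangles.\<close>

lemma Lunit_Tensor:
  assumes XY: "X \<in> Obj B" "Y \<in> Obj B"
  shows "Assoc B (Unit B) X Y \<Zsemi> Lunit B (X \<odot> Y) = Lunit B X \<otimes> Ide B Y"
proof (rule Tensor_Unit_faithful)
  let ?I = "Unit B"
  let ?i = "Ide B ?I"
  let ?a = "Assoc B"
  let ?A = "?a ?I ?I X \<otimes> Ide B Y"
  let ?A' = "inv_arrow B (?a ?I ?I X) \<otimes> Ide B Y"
  have iso: "iso_arrow B ?A"
    unfolding iso_arrow_def inverse_arrows_def
    by (rule exI[of _ ?A']) (simp add: XY Hom_iff)
  \<comment> \<open>Prefixing \<open>?A\<close> completes the left side of the pentagon;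
    \<open>?A\<close> and then the associator after it are invertible and get cancelled at the
    end.\<close>
  have "?A \<Zsemi> (?a ?I (?I \<odot> X) Y \<Zsemi> (?i \<otimes> (?a ?I X Y \<Zsemi> Lunit B (X \<odot> Y))))
     = (?A \<Zsemi> ?a ?I (?I \<odot> X) Y \<Zsemi> (?i \<otimes> ?a ?I X Y)) \<Zsemi> (?i \<otimes> Lunit B (X \<odot> Y))"
    by (simp add: XY)
  also have "\<dots> = (?a (?I \<odot> ?I) X Y \<Zsemi> ?a ?I ?I (X \<odot> Y)) \<Zsemi> (?i \<otimes> Lunit B (X \<odot> Y))"
    by (simp only: pentagon XY Unit_Obj)
  also have "\<dots> = ?a (?I \<odot> ?I) X Y \<Zsemi> (?a ?I ?I (X \<odot> Y) \<Zsemi> (?i \<otimes> Lunit B (X \<odot> Y)))"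
    by (simp add: XY)
  also have "\<dots> = ?a (?I \<odot> ?I) X Y \<Zsemi> (Runit B ?I \<otimes> Ide B (X \<odot> Y))"
    by (simp only: triangle XY Unit_Obj TensorO_Obj)
  also have "\<dots> = ((Runit B ?I \<otimes> Ide B X) \<otimes> Ide B Y) \<Zsemi> ?a ?I X Y"
    using Assoc_nat[of "Runit B ?I" "Ide B X" "Ide B Y"] by (simp add: XY)
  also have "\<dots> = ?A \<Zsemi> (((?i \<otimes> Lunit B X) \<otimes> Ide B Y) \<Zsemi> ?a ?I X Y)"
    by (simp add: XY triangle)
  also have "\<dots> = ?A \<Zsemi> (?a ?I (?I \<odot> X) Y \<Zsemi> (?i \<otimes> (Lunit B X \<otimes> Ide B Y)))"
    using Assoc_nat[of ?i "Lunit B X" "Ide B Y"] by (simp add: XY)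
  finally have "?a ?I (?I \<odot> X) Y \<Zsemi> (?i \<otimes> (?a ?I X Y \<Zsemi> Lunit B (X \<odot> Y)))
      = ?a ?I (?I \<odot> X) Y \<Zsemi> (?i \<otimes> (Lunit B X \<otimes> Ide B Y))"
    by (rule iso_arrow_Comp_cancel[OF iso]) (simp_all add: XY)
  then show "?i \<otimes> (?a ?I X Y \<Zsemi> Lunit B (X \<odot> Y)) = ?i \<otimes> (Lunit B X \<otimes> Ide B Y)"
    by (rule iso_arrow_Comp_cancel[OF Assoc_iso, rotated 3]) (simp_all add: XY)
qed (simp_all add: XY)

end

text \<open>Four independent objects are needed because naturality changes them separately:
  discarding the two middle ones turns X, X, Y, Y into X, I, I, Y, which \<open>interchange\<close>
  cannot express.\<close>

definition middle_interchange ::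
    "('o, 'a, 'z) symmetric_monoidal_category_scheme \<Rightarrow> 'o \<Rightarrow> 'o \<Rightarrow> 'o \<Rightarrow> 'o \<Rightarrow> 'a" where
  "middle_interchange B W X Y Z =
     Assoc B W X (Y \<odot>\<^bsub>B\<^esub> Z)
     \<Zsemi>\<^bsub>B\<^esub> (Ide B W \<otimes>\<^bsub>B\<^esub>
           (inv_arrow B (Assoc B X Y Z) \<Zsemi>\<^bsub>B\<^esub> (Sym B X Y \<otimes>\<^bsub>B\<^esub> Ide B Z) \<Zsemi>\<^bsub>B\<^esub> Assoc B Y X Z))
     \<Zsemi>\<^bsub>B\<^esub> inv_arrow B (Assoc B W Y (X \<odot>\<^bsub>B\<^esub> Z))"

lemma interchange_eq_middle: "interchange B X Y = middle_interchange B X X Y Y"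
  by (simp add: interchange_def middle_interchange_def)

context symmetric_monoidal_category
begin

lemma middle_interchange_simps [simp]:
  assumes "W \<in> Obj B" "X \<in> Obj B" "Y \<in> Obj B" "Z \<in> Obj B"
  shows "middle_interchange B W X Y Z \<in> Arr B"
    "Dom B (middle_interchange B W X Y Z) = (W \<odot> X) \<odot> (Y \<odot> Z)"
    "Cod B (middle_interchange B W X Y Z) = (W \<odot> Y) \<odot> (X \<odot> Z)"
  using assms by (simp_all add: middle_interchange_def)

lemma Sym_nat:
  "\<lbrakk>f \<in> Arr B; g \<in> Arr B\<rbrakk>
    \<Longrightarrow> (f \<otimes> g) \<Zsemi> Sym B (Cod B f) (Cod B g) = Sym B (Dom B f) (Dom B g) \<Zsemi> (g \<otimes> f)"
  using Sym_natural by (simp add: Hom_iff)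

text \<open>Each of the five factors of the swap is natural. The three inner ones, abbreviated
  \<open>?M\<close>, are treated on the last three arrows, then the two outer associators.\<close>

lemma middle_interchange_nat:
  assumes "f \<in> Arr B" "g \<in> Arr B" "h \<in> Arr B" "k \<in> Arr B"
  shows "((f \<otimes> g) \<otimes> (h \<otimes> k)) \<Zsemi> middle_interchange B (Cod B f) (Cod B g) (Cod B h) (Cod B k)
    = middle_interchange B (Dom B f) (Dom B g) (Dom B h) (Dom B k) \<Zsemi> ((f \<otimes> h) \<otimes> (g \<otimes> k))"
proof -
  let ?M = "\<lambda>X Y Z. inv_arrow B (Assoc B X Y Z) \<Zsemi> (Sym B X Y \<otimes> Ide B Z) \<Zsemi> Assoc B Y X Z"
  have "(g \<otimes> (h \<otimes> k)) \<Zsemi> ?M (Cod B g) (Cod B h) (Cod B k)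
      = ((g \<otimes> (h \<otimes> k)) \<Zsemi> inv_arrow B (Assoc B (Cod B g) (Cod B h) (Cod B k))) \<Zsemi>
        ((Sym B (Cod B g) (Cod B h) \<otimes> Ide B (Cod B k)) \<Zsemi> Assoc B (Cod B h) (Cod B g) (Cod B k))"
    using assms by simp
  also have "\<dots> = inv_arrow B (Assoc B (Dom B g) (Dom B h) (Dom B k)) \<Zsemi>
        ((((g \<otimes> h) \<Zsemi> Sym B (Cod B g) (Cod B h)) \<otimes> k) \<Zsemi> Assoc B (Cod B h) (Cod B g) (Cod B k))"
    unfolding inv_Assoc_nat[OF assms(2-4)] using assms by simp
  also have "\<dots> = inv_arrow B (Assoc B (Dom B g) (Dom B h) (Dom B k)) \<Zsemi>
        ((Sym B (Dom B g) (Dom B h) \<otimes> Ide B (Dom B k)) \<Zsemi>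
        (((h \<otimes> g) \<otimes> k) \<Zsemi> Assoc B (Cod B h) (Cod B g) (Cod B k)))"
    unfolding Sym_nat[OF assms(2,3)] using assms by simp
  also have "\<dots> = ?M (Dom B g) (Dom B h) (Dom B k) \<Zsemi> (h \<otimes> (g \<otimes> k))"
    unfolding Assoc_nat[OF assms(3,2,4)] using assms by simp
  finally have M: "(g \<otimes> (h \<otimes> k)) \<Zsemi> ?M (Cod B g) (Cod B h) (Cod B k)
    = ?M (Dom B g) (Dom B h) (Dom B k) \<Zsemi> (h \<otimes> (g \<otimes> k))" .
  have "((f \<otimes> g) \<otimes> (h \<otimes> k)) \<Zsemi> middle_interchange B (Cod B f) (Cod B g) (Cod B h) (Cod B k)
    = (((f \<otimes> g) \<otimes> (h \<otimes> k)) \<Zsemi> Assoc B (Cod B f) (Cod B g) (Cod B (h \<otimes> k))) \<Zsemi>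
      ((Ide B (Cod B f) \<otimes> ?M (Cod B g) (Cod B h) (Cod B k)) \<Zsemi>
       inv_arrow B (Assoc B (Cod B f) (Cod B h) (Cod B (g \<otimes> k))))"
    using assms by (simp add: middle_interchange_def)
  also have "\<dots> = Assoc B (Dom B f) (Dom B g) (Dom B (h \<otimes> k)) \<Zsemi>
      ((f \<otimes> ((g \<otimes> (h \<otimes> k)) \<Zsemi> ?M (Cod B g) (Cod B h) (Cod B k))) \<Zsemi>
       inv_arrow B (Assoc B (Cod B f) (Cod B h) (Cod B (g \<otimes> k))))"
    unfolding Assoc_nat[OF assms(1,2) Tensor_simps(1)[OF assms(3,4)]] using assms by simp
  also have "\<dots> = Assoc B (Dom B f) (Dom B g) (Dom B (h \<otimes> k)) \<Zsemi>
      ((Ide B (Dom B f) \<otimes> ?M (Dom B g) (Dom B h) (Dom B k)) \<Zsemi>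
       ((f \<otimes> (h \<otimes> (g \<otimes> k))) \<Zsemi> inv_arrow B (Assoc B (Cod B f) (Cod B h) (Cod B (g \<otimes> k)))))"
    unfolding M using assms by simp
  also have "\<dots> = middle_interchange B (Dom B f) (Dom B g) (Dom B h) (Dom B k) \<Zsemi> ((f \<otimes> h) \<otimes> (g \<otimes> k))"
    unfolding inv_Assoc_nat[OF assms(1,3) Tensor_simps(1)[OF assms(2,4)]]
    using assms by (simp add: middle_interchange_def)
  finally show ?thesis .
qed

end

section \<open>Adjoints and maps\<close>

text \<open>The formulas of \<open>Fst\<close> and \<open>Snd\<close>, named within the bicategory
  because they are also composed with arrows that need not be maps.\<close>

definition proj1 :: "('o, 'a, 'z) cartesian_bicategory_scheme \<Rightarrow> 'o \<Rightarrow> 'o \<Rightarrow> 'a" where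
  "proj1 B X Y = (Ide B X \<otimes>\<^bsub>B\<^esub> Del B Y) \<Zsemi>\<^bsub>B\<^esub> Runit B X"

definition proj2 :: "('o, 'a, 'z) cartesian_bicategory_scheme \<Rightarrow> 'o \<Rightarrow> 'o \<Rightarrow> 'a" where
  "proj2 B X Y = (Del B X \<otimes>\<^bsub>B\<^esub> Ide B Y) \<Zsemi>\<^bsub>B\<^esub> Lunit B Y"

context cartesian_bicategory
begin

lemma Dup_simps [simp]:
  assumes "X \<in> Obj B"
  shows "Dup B X \<in> Arr B" "Dom B (Dup B X) = X" "Cod B (Dup B X) = X \<odot> X"
  using Dup_Hom[OF assms] by (auto simp: Hom_iff)

lemma Del_simps [simp]:
  assumes "X \<in> Obj B"
  shows "Del B X \<in> Arr B" "Dom B (Del B X) = X" "Cod B (Del B X) = Unit B"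
  using Del_Hom[OF assms] by (auto simp: Hom_iff)

lemma proj_simps [simp]:
  assumes "X \<in> Obj B" "Y \<in> Obj B"
  shows "proj1 B X Y \<in> Arr B" "Dom B (proj1 B X Y) = X \<odot> Y" "Cod B (proj1 B X Y) = X"
    "proj2 B X Y \<in> Arr B" "Dom B (proj2 B X Y) = X \<odot> Y" "Cod B (proj2 B X Y) = Y"
  using assms by (simp_all add: proj1_def proj2_def)

section \<open>Order of arrows, right adjoints and maps\<close>

lemma Leq_refl [simp]: "f \<in> Arr B \<Longrightarrow> f \<preceq> f"
  using partial_order.axioms(1)[OF Hom_poset[of "Dom B f" "Cod B f"]]
  by (auto simp: Hom_order_def Hom_iff dest!: weak_partial_order.le_refl[of _ f])

lemma Leq_trans:
  assumes "f \<preceq> g" "g \<preceq> h" "f \<in> Arr B" "g \<in> Arr B" "h \<in> Arr B"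
    "Dom B f = Dom B g" "Cod B f = Cod B g" "Dom B g = Dom B h" "Cod B g = Cod B h"
  shows "f \<preceq> h"
proof -
  interpret partial_order "Hom_order B (Dom B h) (Cod B h)" using assms by (simp add: Hom_poset)
  show ?thesis using le_trans[of f g h] assms by (simp add: Hom_order_def Hom_iff)
qed

lemma Leq_antisym:
  assumes "f \<preceq> g" "g \<preceq> f" "f \<in> Arr B" "g \<in> Arr B" "Dom B f = Dom B g" "Cod B f = Cod B g"
  shows "f = g"
proof -
  interpret partial_order "Hom_order B (Dom B g) (Cod B g)" using assms by (simp add: Hom_poset)
  show ?thesis using le_antisym[of f g] assms by (simp add: Hom_order_def Hom_iff)
qed

lemma Comp_Leq:
  assumes "f \<preceq> f'" "g \<preceq> g'" "f \<in> Arr B" "f' \<in> Arr B" "g \<in> Arr B" "g' \<in> Arr B"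
    "Dom B f = Dom B f'" "Cod B f = Cod B f'" "Dom B g = Dom B g'" "Cod B g = Cod B g'" "Cod B f' = Dom B g'"
  shows "f \<Zsemi> g \<preceq> f' \<Zsemi> g'"
  using Comp_mono[of f "Dom B f'" "Cod B f'" f' g "Cod B g'" g'] assms by (simp add: Hom_iff)

lemma Tensor_Leq:
  assumes "f \<preceq> f'" "g \<preceq> g'" "f \<in> Arr B" "f' \<in> Arr B" "g \<in> Arr B" "g' \<in> Arr B"
    "Dom B f = Dom B f'" "Cod B f = Cod B f'" "Dom B g = Dom B g'" "Cod B g = Cod B g'"
  shows "f \<otimes> g \<preceq> f' \<otimes> g'"
  using Tensor_mono[of f "Dom B f'" "Cod B f'" f' g "Dom B g'" "Cod B g'" g'] assms by (simp add: Hom_iff)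

lemma Dup_Leq: "f \<in> Arr B \<Longrightarrow> f \<Zsemi> Dup B (Cod B f) \<preceq> Dup B (Dom B f) \<Zsemi> (f \<otimes> f)"
  using Dup_lax by (simp add: Hom_iff)

lemma Del_Leq: "f \<in> Arr B \<Longrightarrow> f \<Zsemi> Del B (Cod B f) \<preceq> Del B (Dom B f)"
  using Del_lax by (simp add: Hom_iff)

lemma right_adjoint_arrow_iff:
  "right_adjoint_arrow B f r \<longleftrightarrow> f \<in> Arr B \<and> r \<in> Arr B \<and> Dom B r = Cod B f \<and> Cod B r = Dom B f \<and>
     Ide B (Dom B f) \<preceq> f \<Zsemi> r \<and> r \<Zsemi> f \<preceq> Ide B (Cod B f)"
  by (auto simp: right_adjoint_arrow_def Hom_iff)

lemma map_arrow_Arr [simp]: "map_arrow B f \<Longrightarrow> f \<in> Arr B"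
  by (simp add: map_arrow_def)

lemma map_arrow_Dup: "map_arrow B f \<Longrightarrow> f \<Zsemi> Dup B (Cod B f) = Dup B (Dom B f) \<Zsemi> (f \<otimes> f)"
  by (simp add: map_arrow_def)

lemma map_arrow_Del: "map_arrow B f \<Longrightarrow> f \<Zsemi> Del B (Cod B f) = Del B (Dom B f)"
  by (simp add: map_arrow_def)

text \<open>Laxness of the right adjoint turns the lax homomorphism laws of \<open>f\<close> into equations. In particular
  all coherence isomorphisms are maps.\<close>

lemma right_adjoint_map_arrow:
  assumes "right_adjoint_arrow B f r"
  shows "map_arrow B f"
proof -
  have simps [simp]: "f \<in> Arr B" "r \<in> Arr B" "Dom B r = Cod B f" "Cod B r = Dom B f"
    and unit: "Ide B (Dom B f) \<preceq> f \<Zsemi> r" and counit: "r \<Zsemi> f \<preceq> Ide B (Cod B f)"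
    using assms by (auto simp: right_adjoint_arrow_iff)
  let ?X = "Dom B f" and ?Y = "Cod B f"
  have "Dup B ?X \<Zsemi> (f \<otimes> f) = Ide B ?X \<Zsemi> (Dup B ?X \<Zsemi> (f \<otimes> f))" by simp
  also have "\<dots> \<preceq> (f \<Zsemi> r) \<Zsemi> (Dup B ?X \<Zsemi> (f \<otimes> f))"
    by (rule Comp_Leq) (simp_all add: unit)
  finally have 1: "Dup B ?X \<Zsemi> (f \<otimes> f) \<preceq> (f \<Zsemi> r) \<Zsemi> (Dup B ?X \<Zsemi> (f \<otimes> f))" .
  have "(f \<Zsemi> r) \<Zsemi> (Dup B ?X \<Zsemi> (f \<otimes> f)) = f \<Zsemi> ((r \<Zsemi> Dup B ?X) \<Zsemi> (f \<otimes> f))" by simp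
  also have "\<dots> \<preceq> f \<Zsemi> ((Dup B ?Y \<Zsemi> (r \<otimes> r)) \<Zsemi> (f \<otimes> f))"
    by (rule Comp_Leq, simp, rule Comp_Leq) (use Dup_Leq[of r] in simp_all)
  finally have 2: "(f \<Zsemi> r) \<Zsemi> (Dup B ?X \<Zsemi> (f \<otimes> f)) \<preceq> f \<Zsemi> ((Dup B ?Y \<Zsemi> (r \<otimes> r)) \<Zsemi> (f \<otimes> f))" .
  have "f \<Zsemi> ((Dup B ?Y \<Zsemi> (r \<otimes> r)) \<Zsemi> (f \<otimes> f)) = f \<Zsemi> (Dup B ?Y \<Zsemi> ((r \<Zsemi> f) \<otimes> (r \<Zsemi> f)))" by simp
  also have "\<dots> \<preceq> f \<Zsemi> (Dup B ?Y \<Zsemi> (Ide B ?Y \<otimes> Ide B ?Y))"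
    by (intro Comp_Leq Tensor_Leq) (simp_all add: counit del: Tensor_Ide)
  finally have 3: "f \<Zsemi> ((Dup B ?Y \<Zsemi> (r \<otimes> r)) \<Zsemi> (f \<otimes> f)) \<preceq> f \<Zsemi> Dup B ?Y" by simp
  have "Dup B ?X \<Zsemi> (f \<otimes> f) \<preceq> f \<Zsemi> Dup B ?Y"
    by (rule Leq_trans[OF 1 Leq_trans[OF 2 3]]) simp_all
  then have dup: "f \<Zsemi> Dup B ?Y = Dup B ?X \<Zsemi> (f \<otimes> f)"
    by (intro Leq_antisym) (use Dup_Leq[of f] in simp_all)
  have "Ide B ?X \<Zsemi> Del B ?X \<preceq> (f \<Zsemi> r) \<Zsemi> Del B ?X"
    by (rule Comp_Leq) (simp_all add: unit)
  then have 4: "Del B ?X \<preceq> f \<Zsemi> (r \<Zsemi> Del B ?X)" by simp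
  have 5: "f \<Zsemi> (r \<Zsemi> Del B ?X) \<preceq> f \<Zsemi> Del B ?Y"
    by (intro Comp_Leq) (use Del_Leq[of r] in simp_all)
  have "f \<Zsemi> Del B ?Y = Del B ?X"
    by (intro Leq_antisym) (use Del_Leq[of f] Leq_trans[OF 4 5] in simp_all)
  with dup show ?thesis by (simp add: map_arrow_def)
qed

lemma right_adjoint_inverse:
  assumes "inverse_arrows B f g"
  shows "right_adjoint_arrow B f g"
  using assms by (simp add: inverse_arrows_def right_adjoint_arrow_iff Hom_iff)

lemma map_arrow_iso: "iso_arrow B f \<Longrightarrow> map_arrow B f"
  by (metis iso_arrow_def right_adjoint_inverse right_adjoint_map_arrow)

lemma map_arrow_inv:
  assumes "iso_arrow B f"
  shows "map_arrow B (inv_arrow B f)"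
proof -
  have "inverse_arrows B f (inv_arrow B f)"
    using assms by (rule inverse_arrows_inv_arrow)
  then have "inverse_arrows B (inv_arrow B f) f"
    by (simp add: inverse_arrows_def Hom_iff)
  then show ?thesis
    by (metis right_adjoint_inverse right_adjoint_map_arrow)
qed

section \<open>Closure of adjoints and maps under composition and tensor\<close>

lemma right_adjoint_Comp:
  assumes "right_adjoint_arrow B f r" "right_adjoint_arrow B g s" "Cod B f = Dom B g"
  shows "right_adjoint_arrow B (f \<Zsemi> g) (s \<Zsemi> r)"
proof -
  have simps [simp]: "f \<in> Arr B" "r \<in> Arr B" "Dom B r = Dom B g" "Cod B r = Dom B f"
    "g \<in> Arr B" "s \<in> Arr B" "Dom B s = Cod B g" "Cod B s = Dom B g" "Cod B f = Dom B g"
    and adj: "Ide B (Dom B f) \<preceq> f \<Zsemi> r" "r \<Zsemi> f \<preceq> Ide B (Dom B g)"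
      "Ide B (Dom B g) \<preceq> g \<Zsemi> s" "s \<Zsemi> g \<preceq> Ide B (Cod B g)"
    using assms by (auto simp: right_adjoint_arrow_iff)
  have "f \<Zsemi> (Ide B (Dom B g) \<Zsemi> r) \<preceq> f \<Zsemi> ((g \<Zsemi> s) \<Zsemi> r)"
    by (intro Comp_Leq) (simp_all add: adj)
  then have "Ide B (Dom B f) \<preceq> f \<Zsemi> (g \<Zsemi> (s \<Zsemi> r))"
    by (intro Leq_trans[OF adj(1), of "f \<Zsemi> (g \<Zsemi> (s \<Zsemi> r))"]) simp_all
  moreover have "s \<Zsemi> ((r \<Zsemi> f) \<Zsemi> g) \<preceq> s \<Zsemi> (Ide B (Dom B g) \<Zsemi> g)"
    by (intro Comp_Leq) (simp_all add: adj)
  then have "s \<Zsemi> (r \<Zsemi> (f \<Zsemi> g)) \<preceq> Ide B (Cod B g)"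
    by (intro Leq_trans[OF _ adj(4), of "s \<Zsemi> (r \<Zsemi> (f \<Zsemi> g))"]) simp_all
  ultimately show ?thesis by (simp add: right_adjoint_arrow_iff)
qed

lemma right_adjoint_Tensor:
  assumes "right_adjoint_arrow B f r" "right_adjoint_arrow B g s"
  shows "right_adjoint_arrow B (f \<otimes> g) (r \<otimes> s)"
proof -
  have simps [simp]: "f \<in> Arr B" "r \<in> Arr B" "Dom B r = Cod B f" "Cod B r = Dom B f"
    "g \<in> Arr B" "s \<in> Arr B" "Dom B s = Cod B g" "Cod B s = Dom B g"
    and adj: "Ide B (Dom B f) \<preceq> f \<Zsemi> r" "r \<Zsemi> f \<preceq> Ide B (Cod B f)"
      "Ide B (Dom B g) \<preceq> g \<Zsemi> s" "s \<Zsemi> g \<preceq> Ide B (Cod B g)"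
    using assms by (auto simp: right_adjoint_arrow_iff)
  have "Ide B (Dom B f) \<otimes> Ide B (Dom B g) \<preceq> (f \<Zsemi> r) \<otimes> (g \<Zsemi> s)"
    "(r \<Zsemi> f) \<otimes> (s \<Zsemi> g) \<preceq> Ide B (Cod B f) \<otimes> Ide B (Cod B g)"
    by (intro Tensor_Leq; simp add: adj)+
  then show ?thesis by (simp add: right_adjoint_arrow_iff)
qed

lemma right_adjoint_Ide: "X \<in> Obj B \<Longrightarrow> right_adjoint_arrow B (Ide B X) (Ide B X)"
  by (simp add: right_adjoint_arrow_iff)

lemma map_arrow_Ide [simp]: "X \<in> Obj B \<Longrightarrow> map_arrow B (Ide B X)"
  using right_adjoint_Ide right_adjoint_map_arrow by blast

lemma map_arrow_Comp [simp]:
  assumes "map_arrow B f" "map_arrow B g" "Cod B f = Dom B g"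
  shows "map_arrow B (f \<Zsemi> g)"
proof -
  have "f \<Zsemi> (g \<Zsemi> Dup B (Cod B g)) = (f \<Zsemi> Dup B (Cod B f)) \<Zsemi> (g \<otimes> g)"
    using assms by (simp add: map_arrow_Dup)
  also have "\<dots> = Dup B (Dom B f) \<Zsemi> ((f \<Zsemi> g) \<otimes> (f \<Zsemi> g))"
    unfolding map_arrow_Dup[OF assms(1)] using assms by simp
  finally have "f \<Zsemi> (g \<Zsemi> Dup B (Cod B g)) = Dup B (Dom B f) \<Zsemi> ((f \<Zsemi> g) \<otimes> (f \<Zsemi> g))" .
  moreover have "f \<Zsemi> (g \<Zsemi> Del B (Cod B g)) = Del B (Dom B f)"
    using assms map_arrow_Del[of f] by (simp add: map_arrow_Del)
  ultimately show ?thesis using assms by (simp add: map_arrow_def)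
qed

lemma map_arrow_Dup_Del [simp]:
  assumes "X \<in> Obj B"
  shows "map_arrow B (Dup B X)" "map_arrow B (Del B X)"
  using Dup_adjoint[OF assms] Del_adjoint[OF assms] right_adjoint_map_arrow by blast+

text \<open>A map comes with the homomorphism equations and not with a right adjoint, so tensoring
  adjoints gives no proof. Instead, \<open>Dup\<close> of a tensor is a tensor of
  \<open>Dup\<close>s followed by the middle swap, and the swap is natural.\<close>

lemma map_arrow_Tensor [simp]:
  assumes "map_arrow B f" "map_arrow B g"
  shows "map_arrow B (f \<otimes> g)"
proof -
  have [simp]: "f \<in> Arr B" "g \<in> Arr B" using assms by simp_all
  have "(f \<otimes> g) \<Zsemi> Dup B (Cod B f \<odot> Cod B g)
    = ((f \<Zsemi> Dup B (Cod B f)) \<otimes> (g \<Zsemi> Dup B (Cod B g))) \<Zsemi> middle_interchange B (Cod B f) (Cod B f) (Cod B g) (Cod B g)"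
    by (simp add: Dup_Tensor interchange_eq_middle)
  also have "\<dots> = (Dup B (Dom B f) \<otimes> Dup B (Dom B g)) \<Zsemi>
      (((f \<otimes> f) \<otimes> (g \<otimes> g)) \<Zsemi> middle_interchange B (Cod B f) (Cod B f) (Cod B g) (Cod B g))"
    by (simp add: assms map_arrow_Dup)
  also have "\<dots> = Dup B (Dom B f \<odot> Dom B g) \<Zsemi> ((f \<otimes> g) \<otimes> (f \<otimes> g))"
    by (simp add: middle_interchange_nat Dup_Tensor interchange_eq_middle)
  finally show ?thesis
    using assms by (simp add: map_arrow_def Del_Tensor)
qed

lemma map_arrow_structural [simp]:
  "\<lbrakk>X \<in> Obj B; Y \<in> Obj B; Z \<in> Obj B\<rbrakk> \<Longrightarrow> map_arrow B (Assoc B X Y Z)"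
  "\<lbrakk>X \<in> Obj B; Y \<in> Obj B; Z \<in> Obj B\<rbrakk> \<Longrightarrow> map_arrow B (inv_arrow B (Assoc B X Y Z))"
  "X \<in> Obj B \<Longrightarrow> map_arrow B (Lunit B X)"
  "X \<in> Obj B \<Longrightarrow> map_arrow B (inv_arrow B (Lunit B X))"
  "X \<in> Obj B \<Longrightarrow> map_arrow B (Runit B X)"
  "X \<in> Obj B \<Longrightarrow> map_arrow B (inv_arrow B (Runit B X))"
  by (simp_all add: map_arrow_iso map_arrow_inv Assoc_iso Lunit_iso Runit_iso)

lemma map_arrow_proj [simp]:
  assumes "X \<in> Obj B" "Y \<in> Obj B"
  shows "map_arrow B (proj1 B X Y)" "map_arrow B (proj2 B X Y)"
  using assms by (simp_all add: proj1_def proj2_def)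

text \<open>Since \<open>Dup I\<close> and \<open>Del I\<close> are canonical, the comonoid laws at \<open>I\<close> yield the coherence laws for the
  unit object directly.\<close>

lemma Runit_Unit: "Runit B (Unit B) = Lunit B (Unit B)"
proof (rule iso_arrow_Comp_cancel)
  show "inv_arrow B (Lunit B (Unit B)) \<Zsemi> Runit B (Unit B) = inv_arrow B (Lunit B (Unit B)) \<Zsemi> Lunit B (Unit B)"
    using Dup_Del_right[of "Unit B"] by (simp add: Dup_Unit Del_Unit)
  show "iso_arrow B (inv_arrow B (Lunit B (Unit B)))"
    unfolding iso_arrow_def inverse_arrows_def by (rule exI[of _ "Lunit B (Unit B)"]) (simp add: Hom_iff)
qed simp_all

lemma Sym_Unit: "Sym B (Unit B) (Unit B) = Ide B (Unit B \<odot> Unit B)"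
proof (rule iso_arrow_Comp_cancel)
  show "inv_arrow B (Lunit B (Unit B)) \<Zsemi> Sym B (Unit B) (Unit B)
    = inv_arrow B (Lunit B (Unit B)) \<Zsemi> Ide B (Unit B \<odot> Unit B)"
    using Dup_cocomm[of "Unit B"] by (simp add: Dup_Unit)
  show "iso_arrow B (inv_arrow B (Lunit B (Unit B)))"
    unfolding iso_arrow_def inverse_arrows_def by (rule exI[of _ "Lunit B (Unit B)"]) (simp add: Hom_iff)
qed simp_all

text \<open>Swapping two units does nothing, by \<open>Sym_Unit\<close>, so the associators around
  the swap cancel in pairs.\<close>

lemma middle_interchange_Unit:
  assumes "X \<in> Obj B" "Y \<in> Obj B"
  shows "middle_interchange B X (Unit B) (Unit B) Y = Ide B ((X \<odot> Unit B) \<odot> (Unit B \<odot> Y))"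
  using assms by (simp add: middle_interchange_def Sym_Unit)

text \<open>Surjective pairing at the identity. The discards slide through the middle swap, which
  then exchanges two units and vanishes; what remains is the right counit law of X tensored with the
  left counit law of Y.\<close>

lemma Dup_Tensor_proj:
  assumes "X \<in> Obj B" "Y \<in> Obj B"
  shows "Dup B (X \<odot> Y) \<Zsemi> (proj1 B X Y \<otimes> proj2 B X Y) = Ide B (X \<odot> Y)"
proof -
  have "Dup B (X \<odot> Y) \<Zsemi> (proj1 B X Y \<otimes> proj2 B X Y)
    = (Dup B X \<otimes> Dup B Y) \<Zsemi> ((middle_interchange B X X Y Y \<Zsemi>
        ((Ide B X \<otimes> Del B Y) \<otimes> (Del B X \<otimes> Ide B Y))) \<Zsemi> (Runit B X \<otimes> Lunit B Y))"
    using assms by (simp add: Dup_Tensor interchange_eq_middle proj1_def proj2_def)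
  also have "middle_interchange B X X Y Y \<Zsemi> ((Ide B X \<otimes> Del B Y) \<otimes> (Del B X \<otimes> Ide B Y))
    = ((Ide B X \<otimes> Del B X) \<otimes> (Del B Y \<otimes> Ide B Y)) \<Zsemi> middle_interchange B X (Unit B) (Unit B) Y"
    using middle_interchange_nat[of "Ide B X" "Del B X" "Del B Y" "Ide B Y"] assms by simp
  also have "\<dots> = (Ide B X \<otimes> Del B X) \<otimes> (Del B Y \<otimes> Ide B Y)"
    using assms by (simp add: middle_interchange_Unit)
  also have "(Dup B X \<otimes> Dup B Y) \<Zsemi> (\<dots> \<Zsemi> (Runit B X \<otimes> Lunit B Y))
    = (Dup B X \<Zsemi> (Ide B X \<otimes> Del B X) \<Zsemi> Runit B X) \<otimes> (Dup B Y \<Zsemi> (Del B Y \<otimes> Ide B Y) \<Zsemi> Lunit B Y)"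
    using assms by simp
  also have "\<dots> = Ide B (X \<odot> Y)"
    using assms by (simp only: Dup_Del_left Dup_Del_right Tensor_Ide)
  finally show ?thesis .
qed

end

section \<open>Projections\<close>

context cartesian_bicategory
begin

text \<open>With unitors read as projections, the projection rules for tensors and associators also
  apply to them.\<close>

lemma proj1_Unit: "X \<in> Obj B \<Longrightarrow> proj1 B X (Unit B) = Runit B X"
  by (simp add: proj1_def Del_Unit)

lemma proj2_Unit: "X \<in> Obj B \<Longrightarrow> proj2 B (Unit B) X = Lunit B X"
  by (simp add: proj2_def Del_Unit)

text \<open>The discarded factor \<open>g\<close> has to be a map, so that \<open>g\<close> followed
  by \<open>Del\<close> is \<open>Del\<close>; \<open>f\<close> may be any arrow, as is needed for
  the predicates in \<open>Hom_meet\<close>.\<close>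

lemma Tensor_proj1 [simp]:
  assumes "f \<in> Arr B" "map_arrow B g" "Cod B f = X" "Cod B g = Y"
  shows "(f \<otimes> g) \<Zsemi> proj1 B X Y = proj1 B (Dom B f) (Dom B g) \<Zsemi> f"
proof -
  have "(f \<otimes> g) \<Zsemi> proj1 B X Y = (Ide B (Dom B f) \<otimes> Del B (Dom B g)) \<Zsemi> ((f \<otimes> Ide B (Unit B)) \<Zsemi> Runit B X)"
    using assms map_arrow_Del[OF assms(2)] by (auto simp: proj1_def)
  also have "\<dots> = proj1 B (Dom B f) (Dom B g) \<Zsemi> f"
    using Runit_nat[OF assms(1)] assms by (auto simp: proj1_def simp del: Comp_Tensor_Comp)
  finally show ?thesis .
qed

lemma Tensor_proj2 [simp]:
  assumes "map_arrow B f" "g \<in> Arr B" "Cod B f = X" "Cod B g = Y"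
  shows "(f \<otimes> g) \<Zsemi> proj2 B X Y = proj2 B (Dom B f) (Dom B g) \<Zsemi> g"
proof -
  have "(f \<otimes> g) \<Zsemi> proj2 B X Y = (Del B (Dom B f) \<otimes> Ide B (Dom B g)) \<Zsemi> ((Ide B (Unit B) \<otimes> g) \<Zsemi> Lunit B Y)"
    using assms map_arrow_Del[OF assms(1)] by (auto simp: proj2_def)
  also have "\<dots> = proj2 B (Dom B f) (Dom B g) \<Zsemi> g"
    using Lunit_nat[OF assms(2)] assms by (auto simp: proj2_def simp del: Comp_Tensor_Comp)
  finally show ?thesis .
qed

lemma Tensor_proj_Comp [simp]:
  "\<lbrakk>f \<in> Arr B; map_arrow B g; Cod B f = X; Cod B g = Y; k \<in> Arr B; Dom B k = X\<rbrakk>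
    \<Longrightarrow> (f \<otimes> g) \<Zsemi> (proj1 B X Y \<Zsemi> k) = proj1 B (Dom B f) (Dom B g) \<Zsemi> (f \<Zsemi> k)"
  "\<lbrakk>map_arrow B f; g \<in> Arr B; Cod B f = X; Cod B g = Y; k \<in> Arr B; Dom B k = Y\<rbrakk>
    \<Longrightarrow> (f \<otimes> g) \<Zsemi> (proj2 B X Y \<Zsemi> k) = proj2 B (Dom B f) (Dom B g) \<Zsemi> (g \<Zsemi> k)"
  using Comp_reassoc[OF Tensor_proj1] Comp_reassoc[OF Tensor_proj2] by auto

lemma Dup_proj [simp]:
  assumes "X \<in> Obj B"
  shows "Dup B X \<Zsemi> proj1 B X X = Ide B X" "Dup B X \<Zsemi> proj2 B X X = Ide B X"
  using Dup_Del_left[OF assms] Dup_Del_right[OF assms] assms by (simp_all add: proj1_def proj2_def)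

lemma Dup_proj_Comp [simp]:
  assumes "k \<in> Arr B" "Dom B k = X"
  shows "Dup B X \<Zsemi> (proj1 B X X \<Zsemi> k) = k" "Dup B X \<Zsemi> (proj2 B X X \<Zsemi> k) = k"
  using assms Comp_reassoc[OF Dup_proj(1)] Comp_reassoc[OF Dup_proj(2)] by auto

text \<open>A map commutes with copying, so \<open>Dup_Tensor_proj\<close> can be applied at its
  codomain. This is the uniqueness half of the product property.\<close>

lemma map_arrow_pair_proj:
  assumes "map_arrow B h" "Cod B h = X \<odot> Y" "X \<in> Obj B" "Y \<in> Obj B"
  shows "Dup B (Dom B h) \<Zsemi> ((h \<Zsemi> proj1 B X Y) \<otimes> (h \<Zsemi> proj2 B X Y)) = h"
proof -
  have "Dup B (Dom B h) \<Zsemi> ((h \<Zsemi> proj1 B X Y) \<otimes> (h \<Zsemi> proj2 B X Y))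
    = (Dup B (Dom B h) \<Zsemi> (h \<otimes> h)) \<Zsemi> (proj1 B X Y \<otimes> proj2 B X Y)"
    using assms by simp
  also have "\<dots> = h \<Zsemi> (Dup B (X \<odot> Y) \<Zsemi> (proj1 B X Y \<otimes> proj2 B X Y))"
    unfolding map_arrow_Dup[OF assms(1), symmetric] using assms by simp
  also have "\<dots> = h"
    using assms by (simp add: Dup_Tensor_proj del: Comp_Tensor)
  finally show ?thesis .
qed

lemma map_arrow_eqI:
  assumes "map_arrow B h" "map_arrow B k" "Dom B h = Dom B k" "Cod B h = X \<odot> Y" "Cod B k = X \<odot> Y"
    "X \<in> Obj B" "Y \<in> Obj B"
    "h \<Zsemi> proj1 B X Y = k \<Zsemi> proj1 B X Y" "h \<Zsemi> proj2 B X Y = k \<Zsemi> proj2 B X Y"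
  shows "h = k"
proof -
  have "h = Dup B (Dom B k) \<Zsemi> ((k \<Zsemi> proj1 B X Y) \<otimes> (k \<Zsemi> proj2 B X Y))"
    using map_arrow_pair_proj[OF assms(1,4,6,7)] unfolding assms(3,8,9) by (rule sym)
  also have "\<dots> = k"
    by (rule map_arrow_pair_proj[OF assms(2,5,6,7)])
  finally show ?thesis .
qed

lemma map_arrow_Unit:
  assumes "map_arrow B f" "Cod B f = Unit B"
  shows "f = Del B (Dom B f)"
  using map_arrow_Del[OF assms(1)] assms by (simp add: Del_Unit)

text \<open>The target X is not presented as a tensor, so there is nothing to project to. Naturality
  of the associator in the discards reduces the law to the triangle.\<close>

lemma Assoc_proj1 [simp]:
  assumes XYZ: "X \<in> Obj B" "Y \<in> Obj B" "Z \<in> Obj B"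
  shows "Assoc B X Y Z \<Zsemi> proj1 B X (Y \<odot> Z) = proj1 B (X \<odot> Y) Z \<Zsemi> proj1 B X Y"
proof -
  let ?I = "Unit B"
  have "Assoc B X Y Z \<Zsemi> proj1 B X (Y \<odot> Z)
    = (Assoc B X Y Z \<Zsemi> (Ide B X \<otimes> (Del B Y \<otimes> Del B Z))) \<Zsemi> ((Ide B X \<otimes> Lunit B ?I) \<Zsemi> Runit B X)"
    using XYZ by (simp add: proj1_def Del_Tensor)
  also have "\<dots> = ((Ide B X \<otimes> Del B Y) \<otimes> Del B Z) \<Zsemi>
      ((Assoc B X ?I ?I \<Zsemi> (Ide B X \<otimes> Lunit B ?I)) \<Zsemi> Runit B X)"
    using Assoc_nat[of "Ide B X" "Del B Y" "Del B Z", symmetric] XYZ by simp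
  also have "\<dots> = ((Ide B X \<otimes> Del B Y) \<otimes> Del B Z) \<Zsemi> ((Runit B X \<otimes> Ide B ?I) \<Zsemi> Runit B X)"
    using XYZ by (simp only: triangle Unit_Obj)
  also have "\<dots> = (proj1 B X Y \<otimes> Del B Z) \<Zsemi> proj1 B X ?I"
    using XYZ by (simp add: proj1_Unit) (simp add: proj1_def)
  also have "\<dots> = proj1 B (X \<odot> Y) Z \<Zsemi> proj1 B X Y"
    using XYZ by simp
  finally show ?thesis .
qed

text \<open>Discarding X turns the associator at X, Y, Z into the one at I, Y, Z, where Kelly's law
  applies.\<close>

lemma Assoc_proj2 [simp]:
  assumes XYZ: "X \<in> Obj B" "Y \<in> Obj B" "Z \<in> Obj B"
  shows "Assoc B X Y Z \<Zsemi> proj2 B X (Y \<odot> Z) = proj2 B X Y \<otimes> Ide B Z"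
proof -
  let ?I = "Unit B"
  have "Assoc B X Y Z \<Zsemi> proj2 B X (Y \<odot> Z)
    = (Assoc B X Y Z \<Zsemi> (Del B X \<otimes> (Ide B Y \<otimes> Ide B Z))) \<Zsemi> Lunit B (Y \<odot> Z)"
    using XYZ by (simp add: proj2_def)
  also have "\<dots> = ((Del B X \<otimes> Ide B Y) \<otimes> Ide B Z) \<Zsemi> (Assoc B ?I Y Z \<Zsemi> Lunit B (Y \<odot> Z))"
    using Assoc_nat[of "Del B X" "Ide B Y" "Ide B Z", symmetric] XYZ by simp
  also have "\<dots> = proj2 B X Y \<otimes> Ide B Z"
    using XYZ by (simp add: Lunit_Tensor proj2_def)
  finally show ?thesis .
qed

lemma Assoc_proj_Comp [simp]:
  assumes "X \<in> Obj B" "Y \<in> Obj B" "Z \<in> Obj B" "k \<in> Arr B"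
  shows "Dom B k = X \<Longrightarrow> Assoc B X Y Z \<Zsemi> (proj1 B X (Y \<odot> Z) \<Zsemi> k) = proj1 B (X \<odot> Y) Z \<Zsemi> (proj1 B X Y \<Zsemi> k)"
    "Dom B k = Y \<odot> Z \<Longrightarrow> Assoc B X Y Z \<Zsemi> (proj2 B X (Y \<odot> Z) \<Zsemi> k) = (proj2 B X Y \<otimes> Ide B Z) \<Zsemi> k"
  using assms Comp_reassoc[OF Assoc_proj1[OF assms(1-3)], of k] Comp_reassoc[OF Assoc_proj2[OF assms(1-3)], of k]
  by simp_all

lemma inv_Assoc_proj [simp]:
  assumes XYZ: "X \<in> Obj B" "Y \<in> Obj B" "Z \<in> Obj B"
  shows "inv_arrow B (Assoc B X Y Z) \<Zsemi> proj1 B (X \<odot> Y) Z = Ide B X \<otimes> proj1 B Y Z"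
    "inv_arrow B (Assoc B X Y Z) \<Zsemi> proj2 B (X \<odot> Y) Z = proj2 B X (Y \<odot> Z) \<Zsemi> proj2 B Y Z"
proof -
  \<comment> \<open>Cleared of the inverse, the first claim compares maps into X \<odot> Y and is
    decided on projections.\<close>
  have *: "Assoc B X Y Z \<Zsemi> (Ide B X \<otimes> proj1 B Y Z) = proj1 B (X \<odot> Y) Z"
    by (rule map_arrow_eqI[of _ _ X Y]) (use XYZ in simp_all)
  show "inv_arrow B (Assoc B X Y Z) \<Zsemi> proj1 B (X \<odot> Y) Z = Ide B X \<otimes> proj1 B Y Z"
    by (rule iso_arrow_Comp_cancel[OF Assoc_iso[of X Y Z]]) (use XYZ * in simp_all)
  show "inv_arrow B (Assoc B X Y Z) \<Zsemi> proj2 B (X \<odot> Y) Z = proj2 B X (Y \<odot> Z) \<Zsemi> proj2 B Y Z"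
    by (rule iso_arrow_Comp_cancel[OF Assoc_iso[of X Y Z]]) (use XYZ * in simp_all)
qed

lemma inv_Assoc_proj2_Comp [simp]:
  assumes "X \<in> Obj B" "Y \<in> Obj B" "Z \<in> Obj B" "k \<in> Arr B" "Dom B k = Z"
  shows "inv_arrow B (Assoc B X Y Z) \<Zsemi> (proj2 B (X \<odot> Y) Z \<Zsemi> k) = proj2 B X (Y \<odot> Z) \<Zsemi> (proj2 B Y Z \<Zsemi> k)"
  using assms Comp_reassoc[OF inv_Assoc_proj(2)[OF assms(1-3)], of k] by simp

lemma Dup_proj1_graph:
  assumes "X \<in> Obj B" "Y \<in> Obj B"
  shows "Dup B (X \<odot> Y) \<Zsemi> (proj1 B X Y \<otimes> Ide B (X \<odot> Y)) = (Dup B X \<otimes> Ide B Y) \<Zsemi> Assoc B X X Y"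
  by (rule map_arrow_eqI[of _ _ X "X \<odot> Y"]) (use assms in \<open>simp_all\<close>)

text \<open>The identity is placed first in the pairing: the copied factor then sits at the right
  end, and an inverse associator suffices without any symmetry.\<close>

lemma Dup_proj2_graph:
  assumes "X \<in> Obj B" "Y \<in> Obj B"
  shows "Dup B (X \<odot> Y) \<Zsemi> (Ide B (X \<odot> Y) \<otimes> proj2 B X Y) = (Ide B X \<otimes> Dup B Y) \<Zsemi> inv_arrow B (Assoc B X Y Y)"
  by (rule map_arrow_eqI[of _ _ "X \<odot> Y" Y]) (use assms in simp_all)

section \<open>Right adjoints of projections and their passage through graphs\<close>

lemma proj1_adjoint:
  assumes "right_adjoint_arrow B (Del B Y) e" "X \<in> Obj B" "Y \<in> Obj B"
  shows "right_adjoint_arrow B (proj1 B X Y) (inv_arrow B (Runit B X) \<Zsemi> (Ide B X \<otimes> e))"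
  unfolding proj1_def
proof (rule right_adjoint_Comp)
  show "right_adjoint_arrow B (Runit B X) (inv_arrow B (Runit B X))"
    using assms by (intro right_adjoint_inverse inverse_arrows_inv_arrow Runit_iso)
qed (use assms in \<open>simp_all add: right_adjoint_Tensor right_adjoint_Ide\<close>)

lemma proj2_adjoint:
  assumes "right_adjoint_arrow B (Del B X) e" "X \<in> Obj B" "Y \<in> Obj B"
  shows "right_adjoint_arrow B (proj2 B X Y) (inv_arrow B (Lunit B Y) \<Zsemi> (e \<otimes> Ide B Y))"
  unfolding proj2_def
proof (rule right_adjoint_Comp)
  show "right_adjoint_arrow B (Lunit B Y) (inv_arrow B (Lunit B Y))"
    using assms by (intro right_adjoint_inverse inverse_arrows_inv_arrow Lunit_iso)
qed (use assms in \<open>simp_all add: right_adjoint_Tensor right_adjoint_Ide\<close>)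

text \<open>\<open>Runit\<close> is the projection away from the unit, so
  \<open>inv_Assoc_proj\<close> computes it on a tensor; this is that formula inverted.\<close>

lemma inv_Runit_Assoc:
  assumes "X \<in> Obj B" "Y \<in> Obj B"
  shows "inv_arrow B (Runit B (X \<odot> Y)) \<Zsemi> Assoc B X Y (Unit B) = Ide B X \<otimes> inv_arrow B (Runit B Y)"
proof (rule iso_arrow_Comp_cancel[OF Runit_iso[of "X \<odot> Y"]])
  have "Runit B (X \<odot> Y) = Assoc B X Y (Unit B) \<Zsemi> (inv_arrow B (Assoc B X Y (Unit B)) \<Zsemi> Runit B (X \<odot> Y))"
    using assms by simp
  also have "\<dots> = Assoc B X Y (Unit B) \<Zsemi> (Ide B X \<otimes> Runit B Y)"
    using assms inv_Assoc_proj(1)[of X Y "Unit B"] by (simp add: proj1_Unit)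
  finally have "Runit B (X \<odot> Y) \<Zsemi> (Ide B X \<otimes> inv_arrow B (Runit B Y)) = Assoc B X Y (Unit B)"
    using assms by simp
  then show "Runit B (X \<odot> Y) \<Zsemi> (inv_arrow B (Runit B (X \<odot> Y)) \<Zsemi> Assoc B X Y (Unit B))
    = Runit B (X \<odot> Y) \<Zsemi> (Ide B X \<otimes> inv_arrow B (Runit B Y))"
    using assms by simp
qed (use assms in simp_all)

text \<open>Kelly's law solved for the inverse arrows.\<close>

lemma inv_Lunit_inv_Assoc:
  assumes "X \<in> Obj B" "Y \<in> Obj B"
  shows "inv_arrow B (Lunit B (X \<odot> Y)) \<Zsemi> inv_arrow B (Assoc B (Unit B) X Y) = inv_arrow B (Lunit B X) \<otimes> Ide B Y"
proof (rule iso_arrow_Comp_cancel[OF Lunit_iso[of "X \<odot> Y"]])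
  have "Assoc B (Unit B) X Y \<Zsemi> (Lunit B (X \<odot> Y) \<Zsemi> (inv_arrow B (Lunit B X) \<otimes> Ide B Y))
    = Assoc B (Unit B) X Y \<Zsemi> inv_arrow B (Assoc B (Unit B) X Y)"
    using assms by (simp add: Comp_reassoc[OF Lunit_Tensor])
  then have "Lunit B (X \<odot> Y) \<Zsemi> (inv_arrow B (Lunit B X) \<otimes> Ide B Y) = inv_arrow B (Assoc B (Unit B) X Y)"
    by (rule iso_arrow_Comp_cancel[OF Assoc_iso, rotated 3]) (use assms in simp_all)
  then show "Lunit B (X \<odot> Y) \<Zsemi> (inv_arrow B (Lunit B (X \<odot> Y)) \<Zsemi> inv_arrow B (Assoc B (Unit B) X Y))
    = Lunit B (X \<odot> Y) \<Zsemi> (inv_arrow B (Lunit B X) \<otimes> Ide B Y)"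
    using assms by simp
qed (use assms in simp_all)

text \<open>\<open>r\<close> need not be a map, so projections do not decide this equation. Once the
  graph is rewritten, \<open>Dup X\<close> slides past the inverse unitor and \<open>e\<close> past
  the associator; the unitor and associator left over combine by
  \<open>inv_Runit_Assoc\<close>.\<close>

lemma proj1_adjoint_graph:
  assumes X: "X \<in> Obj B" and e: "e \<in> Arr B" "Dom B e = Unit B" "Cod B e = Y"
  defines "r \<equiv> inv_arrow B (Runit B X) \<Zsemi> (Ide B X \<otimes> e)"
  shows "r \<Zsemi> (Dup B (X \<odot> Y) \<Zsemi> (proj1 B X Y \<otimes> Ide B (X \<odot> Y))) = Dup B X \<Zsemi> (Ide B X \<otimes> r)"
proof -
  have Y: "Y \<in> Obj B" using e by auto
  have "r \<Zsemi> (Dup B (X \<odot> Y) \<Zsemi> (proj1 B X Y \<otimes> Ide B (X \<odot> Y)))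
    = (inv_arrow B (Runit B X) \<Zsemi> (Dup B X \<otimes> Ide B (Unit B))) \<Zsemi>
      (((Ide B X \<otimes> Ide B X) \<otimes> e) \<Zsemi> Assoc B X X Y)"
    unfolding r_def Dup_proj1_graph[OF X Y] using X Y e by simp
  also have "\<dots> = (Dup B X \<Zsemi> inv_arrow B (Runit B (X \<odot> X))) \<Zsemi>
      (Assoc B X X (Unit B) \<Zsemi> (Ide B X \<otimes> (Ide B X \<otimes> e)))"
    using inv_Runit_nat[of "Dup B X"] Assoc_nat[of "Ide B X" "Ide B X" e] X Y e by simp
  also have "\<dots> = Dup B X \<Zsemi> ((inv_arrow B (Runit B (X \<odot> X)) \<Zsemi> Assoc B X X (Unit B)) \<Zsemi>
      (Ide B X \<otimes> (Ide B X \<otimes> e)))"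
    using X Y e by simp
  also have "\<dots> = Dup B X \<Zsemi> (Ide B X \<otimes> r)"
    unfolding inv_Runit_Assoc[OF X X] r_def using X Y e by simp
  finally show ?thesis .
qed

lemma proj2_adjoint_graph:
  assumes Y: "Y \<in> Obj B" and e: "e \<in> Arr B" "Dom B e = Unit B" "Cod B e = X"
  defines "r \<equiv> inv_arrow B (Lunit B Y) \<Zsemi> (e \<otimes> Ide B Y)"
  shows "r \<Zsemi> (Dup B (X \<odot> Y) \<Zsemi> (Ide B (X \<odot> Y) \<otimes> proj2 B X Y)) = Dup B Y \<Zsemi> (r \<otimes> Ide B Y)"
proof -
  have X: "X \<in> Obj B" using e by auto
  have "r \<Zsemi> (Dup B (X \<odot> Y) \<Zsemi> (Ide B (X \<odot> Y) \<otimes> proj2 B X Y))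
    = (inv_arrow B (Lunit B Y) \<Zsemi> (Ide B (Unit B) \<otimes> Dup B Y)) \<Zsemi>
      ((e \<otimes> (Ide B Y \<otimes> Ide B Y)) \<Zsemi> inv_arrow B (Assoc B X Y Y))"
    unfolding r_def Dup_proj2_graph[OF X Y] using X Y e by simp
  also have "\<dots> = (Dup B Y \<Zsemi> inv_arrow B (Lunit B (Y \<odot> Y))) \<Zsemi>
      (inv_arrow B (Assoc B (Unit B) Y Y) \<Zsemi> ((e \<otimes> Ide B Y) \<otimes> Ide B Y))"
    using inv_Lunit_nat[of "Dup B Y"] inv_Assoc_nat[of e "Ide B Y" "Ide B Y"] X Y e by simp
  also have "\<dots> = Dup B Y \<Zsemi> ((inv_arrow B (Lunit B (Y \<odot> Y)) \<Zsemi> inv_arrow B (Assoc B (Unit B) Y Y)) \<Zsemi>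
      ((e \<otimes> Ide B Y) \<otimes> Ide B Y))"
    using X Y e by simp
  also have "\<dots> = Dup B Y \<Zsemi> (r \<otimes> Ide B Y)"
    unfolding inv_Lunit_inv_Assoc[OF Y Y] r_def using X Y e by simp
  finally show ?thesis .
qed

text \<open>Informally, both sides relate \<open>(x, a, b)\<close> to \<open>(x, a)\<close> when \<open>a = b\<close>. The Frobenius law identifies
  them after the graph of the first projection of \<open>A \<odot> A\<close> is rewritten as \<open>Dup A \<otimes> id\<close>.\<close>

lemma equality_restriction:
  assumes XA: "X \<in> Obj B" "A \<in> Obj B" and r: "right_adjoint_arrow B (Dup B A) r"
  shows "Dup B (X \<odot> (A \<odot> A)) \<Zsemi> ((Ide B X \<otimes> proj1 B A A) \<otimes> (proj2 B X (A \<odot> A) \<Zsemi> (r \<Zsemi> Del B A)))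
      \<Zsemi> Runit B (X \<odot> A) = Ide B X \<otimes> r"
proof -
  have r_simps [simp]: "r \<in> Arr B" "Dom B r = A \<odot> A" "Cod B r = A"
    using r XA by (auto simp: right_adjoint_arrow_iff)
  let ?d = "(Dup B A \<otimes> Ide B A) \<Zsemi> Assoc B A A A"
  let ?i = "\<lambda>Z. inv_arrow B (Assoc B X A Z)"
  \<comment> \<open>On elements both sides send (x, (a, b)) to ((x, a), (a, b)). Only maps occur
    here; \<open>r\<close> is attached afterwards.\<close>
  have k: "Dup B (X \<odot> (A \<odot> A)) \<Zsemi> ((Ide B X \<otimes> proj1 B A A) \<otimes> proj2 B X (A \<odot> A)) = (Ide B X \<otimes> ?d) \<Zsemi> ?i (A \<odot> A)"
    by (rule map_arrow_eqI[of _ _ "X \<odot> A" "A \<odot> A"]) (use XA in simp_all)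
  have "Dup B (X \<odot> (A \<odot> A)) \<Zsemi> ((Ide B X \<otimes> proj1 B A A) \<otimes> (proj2 B X (A \<odot> A) \<Zsemi> (r \<Zsemi> Del B A))) \<Zsemi> Runit B (X \<odot> A)
    = (Dup B (X \<odot> (A \<odot> A)) \<Zsemi> ((Ide B X \<otimes> proj1 B A A) \<otimes> proj2 B X (A \<odot> A))) \<Zsemi>
      (((Ide B X \<otimes> Ide B A) \<otimes> (r \<Zsemi> Del B A)) \<Zsemi> Runit B (X \<odot> A))"
    using XA by simp
  also have "\<dots> = (Ide B X \<otimes> ?d) \<Zsemi> ((?i (A \<odot> A) \<Zsemi> ((Ide B X \<otimes> Ide B A) \<otimes> (r \<Zsemi> Del B A))) \<Zsemi> Runit B (X \<odot> A))"
    unfolding k using XA by simp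
  also have "\<dots> = (Ide B X \<otimes> ?d) \<Zsemi> ((Ide B X \<otimes> (Ide B A \<otimes> (r \<Zsemi> Del B A))) \<Zsemi> (?i (Unit B) \<Zsemi> proj1 B (X \<odot> A) (Unit B)))"
    using inv_Assoc_nat[of "Ide B X" "Ide B A" "r \<Zsemi> Del B A", symmetric] XA
    by (simp add: proj1_Unit del: inv_Assoc_proj)
  \<comment> \<open>The discard followed by the unitor is the first projection of A \<odot> A, which
    leaves the left side of the Frobenius law. Its right side is \<open>r\<close> followed by
    \<open>Dup\<close>, and the projection undoes that copying.\<close>
  also have "\<dots> = Ide B X \<otimes> (((Dup B A \<otimes> Ide B A) \<Zsemi> Assoc B A A A \<Zsemi> (Ide B A \<otimes> r)) \<Zsemi> proj1 B A A)"
    unfolding inv_Assoc_proj(1)[OF XA Unit_Obj] proj1_Unit[OF XA(2)]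
    using XA by (simp add: proj1_def)
  also have "\<dots> = Ide B X \<otimes> r"
    using XA frobenius[OF XA(2) r] by simp
  finally show ?thesis .
qed

end

section \<open>The category of maps and the functor to semilattices\<close>

text \<open>Of the comparison equations only two are exported: \<open>v \<Zsemi> q = p'\<close>
  turns a right adjoint of \<open>q\<close> into one of \<open>p'\<close>, and
  \<open>u \<Zsemi> f' = g\<close> carries the exchange law across.\<close>

lemma (in category) pullback_unique:
  assumes "pullback C f' p' p f" "pullback C g q p f"
  obtains u v where "inverse_arrows C v u" "Dom C v = Dom C p'" "Cod C v = Dom C q"
    "u \<Zsemi> f' = g" "v \<Zsemi> q = p'"
proof -
  have sq: "{f', p', p, f} \<subseteq> Arr C" "Dom C f' = Dom C p'" "Cod C f' = Dom C p" "Cod C p' = Dom C f"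
    "f' \<Zsemi> p = p' \<Zsemi> f"
    and U: "\<forall>T \<in> Obj C. \<forall>h \<in> Hom C T (Dom C p). \<forall>k \<in> Hom C T (Dom C f).
      h \<Zsemi> p = k \<Zsemi> f \<longrightarrow> (\<exists>!u. u \<in> Hom C T (Dom C f') \<and> u \<Zsemi> f' = h \<and> u \<Zsemi> p' = k)"
    using assms(1) unfolding pullback_def by - (elim conjE, assumption)+
  have sq': "{g, q, p, f} \<subseteq> Arr C" "Dom C g = Dom C q" "Cod C g = Dom C p" "Cod C q = Dom C f"
    "g \<Zsemi> p = q \<Zsemi> f"
    and U': "\<forall>T \<in> Obj C. \<forall>h \<in> Hom C T (Dom C p). \<forall>k \<in> Hom C T (Dom C f).
      h \<Zsemi> p = k \<Zsemi> f \<longrightarrow> (\<exists>!u. u \<in> Hom C T (Dom C g) \<and> u \<Zsemi> g = h \<and> u \<Zsemi> q = k)"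
    using assms(2) unfolding pullback_def by - (elim conjE, assumption)+
  have arr: "f' \<in> Arr C" "p' \<in> Arr C" "g \<in> Arr C" "q \<in> Arr C"
    "f' \<in> Hom C (Dom C p') (Dom C p)" "p' \<in> Hom C (Dom C p') (Dom C f)"
    "g \<in> Hom C (Dom C q) (Dom C p)" "q \<in> Hom C (Dom C q) (Dom C f)"
    using sq(1-4) sq'(1-4) by (simp_all add: Hom_iff)
  note eqs = sq(5) sq'(5)
  have uni: "\<exists>!u. u \<in> Hom C T (Dom C p') \<and> u \<Zsemi> f' = h \<and> u \<Zsemi> p' = k"
      "\<exists>!u. u \<in> Hom C T (Dom C q) \<and> u \<Zsemi> g = h \<and> u \<Zsemi> q = k"
    if "T \<in> Obj C" "h \<in> Hom C T (Dom C p)" "k \<in> Hom C T (Dom C f)" "h \<Zsemi> p = k \<Zsemi> f" for T h k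
    using U[THEN bspec, OF that(1), THEN bspec, OF that(2), THEN bspec, OF that(3), THEN mp, OF that(4)]
      U'[THEN bspec, OF that(1), THEN bspec, OF that(2), THEN bspec, OF that(3), THEN mp, OF that(4)]
    unfolding sq(2) sq'(2) .
  obtain u where u: "u \<in> Hom C (Dom C q) (Dom C p')" "u \<Zsemi> f' = g" "u \<Zsemi> p' = q"
    using uni(1)[OF _ arr(7,8) eqs(2)] arr(4) by auto
  obtain v where v: "v \<in> Hom C (Dom C p') (Dom C q)" "v \<Zsemi> g = f'" "v \<Zsemi> q = p'"
    using uni(2)[OF _ arr(5,6) eqs(1)] arr(2) by auto
  \<comment> \<open>Both \<open>v \<Zsemi> u\<close> and the identity factor the cone
    \<open>f'\<close>, \<open>p'\<close> through itself, so uniqueness identifies them.\<close>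
  have "\<exists>!w. w \<in> Hom C (Dom C p') (Dom C p') \<and> w \<Zsemi> f' = f' \<and> w \<Zsemi> p' = p'"
    using uni(1)[OF _ arr(5,6) eqs(1)] arr(2) by simp
  moreover have "v \<Zsemi> u \<in> Hom C (Dom C p') (Dom C p') \<and> (v \<Zsemi> u) \<Zsemi> f' = f' \<and> (v \<Zsemi> u) \<Zsemi> p' = p'"
    using u v arr by (auto simp: Hom_iff)
  moreover have "Ide C (Dom C p') \<in> Hom C (Dom C p') (Dom C p') \<and> Ide C (Dom C p') \<Zsemi> f' = f' \<and>
      Ide C (Dom C p') \<Zsemi> p' = p'"
    using arr by (auto simp: Hom_iff)
  ultimately have vu: "v \<Zsemi> u = Ide C (Dom C p')" by blast
  have "\<exists>!w. w \<in> Hom C (Dom C q) (Dom C q) \<and> w \<Zsemi> g = g \<and> w \<Zsemi> q = q"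
    using uni(2)[OF _ arr(7,8) eqs(2)] arr(4) by simp
  moreover have "u \<Zsemi> v \<in> Hom C (Dom C q) (Dom C q) \<and> (u \<Zsemi> v) \<Zsemi> g = g \<and> (u \<Zsemi> v) \<Zsemi> q = q"
    using u v arr by (auto simp: Hom_iff)
  moreover have "Ide C (Dom C q) \<in> Hom C (Dom C q) (Dom C q) \<and> Ide C (Dom C q) \<Zsemi> g = g \<and>
      Ide C (Dom C q) \<Zsemi> q = q"
    using arr by (auto simp: Hom_iff)
  ultimately have uv: "u \<Zsemi> v = Ide C (Dom C q)" by blast
  show thesis
    by (rule that[of v u]) (use u v uv vu in \<open>simp_all add: inverse_arrows_def Hom_iff\<close>)
qed

lemma Map_category_simps [simp]:
  "Obj (Map_category B) = Obj B" "Arr (Map_category B) = {f. map_arrow B f}"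
  "Dom (Map_category B) = Dom B" "Cod (Map_category B) = Cod B" "Ide (Map_category B) = Ide B"
  "Comp (Map_category B) = Comp B" "Prod (Map_category B) = TensorO B"
  "Fst (Map_category B) = proj1 B" "Snd (Map_category B) = proj2 B" "One (Map_category B) = Unit B"
  by (simp_all add: Map_category_def proj1_def[abs_def] proj2_def[abs_def])

definition Hom_meet :: "('o, 'a, 'z) cartesian_bicategory_scheme \<Rightarrow> 'a \<Rightarrow> 'a \<Rightarrow> 'a" where
  "Hom_meet B R S = Dup B (Dom B R) \<Zsemi>\<^bsub>B\<^esub> (R \<otimes>\<^bsub>B\<^esub> S) \<Zsemi>\<^bsub>B\<^esub> Lunit B (Unit B)"

context cartesian_bicategory
begin

section \<open>Finite products in the category of maps\<close>

lemma Map_Hom_iff: "f \<in> Hom (Map_category B) X Y \<longleftrightarrow> map_arrow B f \<and> Dom B f = X \<and> Cod B f = Y"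
  by (simp add: Hom_def)

lemma pair_proj:
  assumes "map_arrow B f" "map_arrow B g" "Dom B f = Dom B g"
  shows "(Dup B (Dom B g) \<Zsemi> (f \<otimes> g)) \<Zsemi> proj1 B (Cod B f) (Cod B g) = f"
    "(Dup B (Dom B g) \<Zsemi> (f \<otimes> g)) \<Zsemi> proj2 B (Cod B f) (Cod B g) = g"
  using assms by simp_all

text \<open>The two homomorphism equations of a map give the two uniqueness claims: the one for
  \<open>Dup\<close> through \<open>map_arrow_pair_proj\<close>, the one for \<open>Del\<close>
  through \<open>map_arrow_Unit\<close>.\<close>

lemma cartesian_category_Map: "cartesian_category (Map_category B)"
proof (unfold_locales, unfold Map_Hom_iff Map_category_simps)
  fix X Y f g assume *: "X \<in> Obj B" "Y \<in> Obj B"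
  fix Z assume f: "map_arrow B f \<and> Dom B f = Z \<and> Cod B f = X"
    and g: "map_arrow B g \<and> Dom B g = Z \<and> Cod B g = Y"
  show "\<exists>!h. (map_arrow B h \<and> Dom B h = Z \<and> Cod B h = X \<odot> Y) \<and> h \<Zsemi> proj1 B X Y = f \<and> h \<Zsemi> proj2 B X Y = g"
  proof (rule ex1I[of _ "Dup B Z \<Zsemi> (f \<otimes> g)"])
    show "(map_arrow B (Dup B Z \<Zsemi> (f \<otimes> g)) \<and> Dom B (Dup B Z \<Zsemi> (f \<otimes> g)) = Z \<and>
        Cod B (Dup B Z \<Zsemi> (f \<otimes> g)) = X \<odot> Y) \<and>
      (Dup B Z \<Zsemi> (f \<otimes> g)) \<Zsemi> proj1 B X Y = f \<and> (Dup B Z \<Zsemi> (f \<otimes> g)) \<Zsemi> proj2 B X Y = g"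
      using f g * by auto
  next
    fix h assume "(map_arrow B h \<and> Dom B h = Z \<and> Cod B h = X \<odot> Y) \<and> h \<Zsemi> proj1 B X Y = f \<and> h \<Zsemi> proj2 B X Y = g"
    then show "h = Dup B Z \<Zsemi> (f \<otimes> g)"
      using map_arrow_pair_proj[of h X Y] * by auto
  qed
next
  fix X assume "X \<in> Obj B"
  then show "\<exists>!t. map_arrow B t \<and> Dom B t = X \<and> Cod B t = Unit B"
    by (intro ex1I[of _ "Del B X"]) (auto simp: map_arrow_Unit)
qed auto

lemma Map_pairing:
  assumes "map_arrow B f" "map_arrow B g" "Dom B f = Dom B g"
  shows "pairing (Map_category B) f g = Dup B (Dom B g) \<Zsemi> (f \<otimes> g)"
proof -
  interpret M: cartesian_category "Map_category B" by (rule cartesian_category_Map)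
  have "\<exists>!h. h \<in> Hom (Map_category B) (Dom B g) (Cod B f \<odot> Cod B g) \<and>
      h \<Zsemi> proj1 B (Cod B f) (Cod B g) = f \<and> h \<Zsemi> proj2 B (Cod B f) (Cod B g) = g"
    using M.Prod_universal[of "Cod B f" "Cod B g" f "Dom B g" g] assms by (simp add: Map_Hom_iff)
  moreover have "Dup B (Dom B g) \<Zsemi> (f \<otimes> g) \<in> Hom (Map_category B) (Dom B g) (Cod B f \<odot> Cod B g)"
    using assms by (simp add: Map_Hom_iff)
  ultimately show ?thesis
    unfolding pairing_def using assms pair_proj[OF assms] by (intro the1_equality) simp_all
qed

lemma Map_prod_arrow:
  assumes "map_arrow B f" "map_arrow B g"
  shows "prod_arrow (Map_category B) f g = f \<otimes> g"
  using assms map_arrow_pair_proj[of "f \<otimes> g" "Cod B f" "Cod B g"]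
  by (simp add: prod_arrow_def Map_pairing)

lemma Map_diagonal: "A \<in> Obj B \<Longrightarrow> diagonal (Map_category B) A = Dup B A"
  by (simp add: diagonal_def Map_pairing)

section \<open>Meets and top element of Hom(X, I)\<close>

lemma Hom_functor_obj_simps [simp]:
  "carrier (Hom_functor_obj B X) = Hom B X (Unit B)"
  "le (Hom_functor_obj B X) = (\<preceq>)" "eq (Hom_functor_obj B X) = (=)"
  by (simp_all add: Hom_functor_obj_def Hom_order_def)

lemma Hom_functor_obj_order: "X \<in> Obj B \<Longrightarrow> partial_order (Hom_functor_obj B X)"
  by (simp add: Hom_functor_obj_def Hom_poset)

lemma Hom_meet_simps [simp]:
  assumes "R \<in> Arr B" "S \<in> Arr B" "Dom B S = Dom B R" "Cod B R = Unit B" "Cod B S = Unit B"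
  shows "Hom_meet B R S \<in> Arr B" "Dom B (Hom_meet B R S) = Dom B R" "Cod B (Hom_meet B R S) = Unit B"
  using assms by (simp_all add: Hom_meet_def)

lemma Hom_Del_top:
  assumes "R \<in> Arr B" "Cod B R = Unit B"
  shows "R \<preceq> Del B (Dom B R)"
  using Del_Leq[of R] assms by (simp add: Del_Unit)

text \<open>Enlarging the other argument to the top \<open>Del\<close> enlarges the meet, and
  copying followed by discarding one copy is the identity.\<close>

lemma Hom_meet_lower:
  assumes "R \<in> Arr B" "S \<in> Arr B" "Dom B S = Dom B R" "Cod B R = Unit B" "Cod B S = Unit B"
  shows "Hom_meet B R S \<preceq> R" "Hom_meet B R S \<preceq> S"
proof -
  let ?X = "Dom B R" and ?I = "Unit B"
  have "Dup B ?X \<Zsemi> ((R \<otimes> S) \<Zsemi> Lunit B ?I) \<preceq> Dup B ?X \<Zsemi> ((R \<otimes> Del B ?X) \<Zsemi> Lunit B ?I)"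
    "Dup B ?X \<Zsemi> ((R \<otimes> S) \<Zsemi> Lunit B ?I) \<preceq> Dup B ?X \<Zsemi> ((Del B ?X \<otimes> S) \<Zsemi> Lunit B ?I)"
    using assms Hom_Del_top[of R] Hom_Del_top[of S]
    by (simp_all add: Comp_Leq Tensor_Leq)
  moreover have "(R \<otimes> Del B ?X) \<Zsemi> Lunit B ?I = proj1 B ?X ?X \<Zsemi> R"
    using assms Tensor_proj1[of R "Del B ?X" ?I ?I] by (simp add: proj1_Unit Runit_Unit)
  moreover have "(Del B ?X \<otimes> S) \<Zsemi> Lunit B ?I = proj2 B ?X ?X \<Zsemi> S"
    using assms Tensor_proj2[of "Del B ?X" S ?I ?I] by (simp add: proj2_Unit)
  ultimately show "Hom_meet B R S \<preceq> R" "Hom_meet B R S \<preceq> S"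
    using assms by (simp_all add: Hom_meet_def)
qed

text \<open>This is the lax copying law of \<open>T\<close>. As \<open>Dup I\<close> is inverse to
  \<open>Lunit I\<close>, that law reads \<open>T\<close> \<preceq> \<open>Hom_meet B T T\<close>,
  and monotonicity does the rest.\<close>

lemma Hom_meet_greatest:
  assumes "R \<in> Arr B" "S \<in> Arr B" "Dom B S = Dom B R" "Cod B R = Unit B" "Cod B S = Unit B"
    "T \<in> Arr B" "Dom B T = Dom B R" "Cod B T = Unit B" "T \<preceq> R" "T \<preceq> S"
  shows "T \<preceq> Hom_meet B R S"
proof -
  let ?X = "Dom B R" and ?I = "Unit B"
  have "(T \<Zsemi> Dup B ?I) \<Zsemi> Lunit B ?I \<preceq> (Dup B ?X \<Zsemi> (T \<otimes> T)) \<Zsemi> Lunit B ?I"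
    by (rule Comp_Leq) (use Dup_Leq[of T] assms in simp_all)
  then have 1: "T \<preceq> Dup B ?X \<Zsemi> ((T \<otimes> T) \<Zsemi> Lunit B ?I)"
    using assms by (simp add: Dup_Unit)
  have 2: "Dup B ?X \<Zsemi> ((T \<otimes> T) \<Zsemi> Lunit B ?I) \<preceq> Dup B ?X \<Zsemi> ((R \<otimes> S) \<Zsemi> Lunit B ?I)"
    using assms by (simp add: Comp_Leq Tensor_Leq)
  show ?thesis
    using Leq_trans[OF 1 2] assms by (simp add: Hom_meet_def)
qed

lemma Hom_glb:
  assumes "R \<in> Hom B X (Unit B)" "S \<in> Hom B X (Unit B)"
  shows "greatest (Hom_functor_obj B X) (Hom_meet B R S) (Lower (Hom_functor_obj B X) {R, S})"
  unfolding greatest_def Lower_def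
  using assms Hom_meet_lower[of R S] Hom_meet_greatest[of R S] by (auto simp: Hom_iff)

text \<open>The meet of the order is some greatest lower bound picked by a choice operator;
  antisymmetry leaves only one candidate.\<close>

lemma Hom_meet_eq:
  assumes "X \<in> Obj B" "R \<in> Hom B X (Unit B)" "S \<in> Hom B X (Unit B)"
  shows "R \<sqinter>\<^bsub>Hom_functor_obj B X\<^esub> S = Hom_meet B R S"
proof -
  interpret partial_order "Hom_functor_obj B X" using assms by (simp add: Hom_functor_obj_order)
  have "greatest (Hom_functor_obj B X) (R \<sqinter>\<^bsub>Hom_functor_obj B X\<^esub> S) (Lower (Hom_functor_obj B X) {R, S})"
    unfolding meet_def inf_def using Hom_glb[OF assms(2,3)] by (rule someI)
  then show ?thesis using Hom_glb[OF assms(2,3)] by (rule greatest_unique)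
qed

lemma Hom_greatest: "X \<in> Obj B \<Longrightarrow> greatest (Hom_functor_obj B X) (Del B X) (Hom B X (Unit B))"
  unfolding greatest_def using Hom_Del_top by (auto simp: Hom_iff)

lemma Hom_top_eq:
  assumes "X \<in> Obj B"
  shows "\<top>\<^bsub>Hom_functor_obj B X\<^esub> = Del B X"
proof -
  interpret partial_order "Hom_functor_obj B X" using assms by (simp add: Hom_functor_obj_order)
  have "greatest (Hom_functor_obj B X) \<top>\<^bsub>Hom_functor_obj B X\<^esub> (Hom B X (Unit B))"
    unfolding top_def using someI[of "\<lambda>x. greatest (Hom_functor_obj B X) x (Hom B X (Unit B))"] Hom_greatest[OF assms]
    by simp
  then show ?thesis using Hom_greatest[OF assms] by (rule greatest_unique)
qed

lemma Hom_functor_obj_InfSL: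
  assumes "X \<in> Obj B"
  shows "InfSL_object (Hom_functor_obj B X)"
proof -
  interpret partial_order "Hom_functor_obj B X" using assms by (simp add: Hom_functor_obj_order)
  show ?thesis
    unfolding InfSL_object_def
  proof
    show "lower_semilattice (Hom_functor_obj B X)"
      by unfold_locales (use Hom_glb in auto)
    show "weak_partial_order_top (Hom_functor_obj B X)"
      by unfold_locales (use Hom_greatest[OF assms] in auto)
  qed
qed

lemma map_arrow_Hom_meet:
  assumes "map_arrow B f" "R \<in> Arr B" "S \<in> Arr B" "Dom B R = Cod B f" "Dom B S = Cod B f"
    "Cod B R = Unit B" "Cod B S = Unit B"
  shows "f \<Zsemi> Hom_meet B R S = Hom_meet B (f \<Zsemi> R) (f \<Zsemi> S)"
proof -
  have "f \<Zsemi> Hom_meet B R S = (f \<Zsemi> Dup B (Cod B f)) \<Zsemi> ((R \<otimes> S) \<Zsemi> Lunit B (Unit B))"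
    using assms by (simp add: Hom_meet_def)
  also have "\<dots> = Hom_meet B (f \<Zsemi> R) (f \<Zsemi> S)"
    unfolding map_arrow_Dup[OF assms(1)] using assms by (simp add: Hom_meet_def)
  finally show ?thesis .
qed

lemma InfSL_functor_Hom: "InfSL_functor (Map_category B) (Hom_functor_obj B) (Hom_functor_arr B)"
proof -
  interpret M: cartesian_category "Map_category B" by (rule cartesian_category_Map)
  show ?thesis
  proof (unfold_locales, unfold Map_Hom_iff Map_category_simps)
    fix X Y f assume f: "map_arrow B f \<and> Dom B f = X \<and> Cod B f = Y"
    then have "X \<in> Obj B" "Y \<in> Obj B" by auto
    then show "InfSL_hom (Hom_functor_obj B Y) (Hom_functor_obj B X) (Hom_functor_arr B f)"
      unfolding InfSL_hom_def Hom_functor_arr_def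
      using f by (auto simp: Hom_top_eq Hom_meet_eq Hom_iff map_arrow_Del map_arrow_Hom_meet)
  qed (auto simp: Hom_functor_obj_InfSL Hom_functor_arr_def Hom_iff)
qed

text \<open>Precomposition reverses sides, so a right adjoint arrow acts as a left adjoint: the unit
  gives \<open>U\<close> \<preceq> \<open>f \<Zsemi> (r \<Zsemi> U)\<close>, the counit
  \<open>r \<Zsemi> (f \<Zsemi> V)\<close> \<preceq> \<open>V\<close>.\<close>

lemma right_adjoint_Leq_iff:
  assumes "right_adjoint_arrow B f r" "U \<in> Arr B" "V \<in> Arr B" "Dom B U = Dom B f" "Dom B V = Cod B f"
    "Cod B U = Cod B V"
  shows "r \<Zsemi> U \<preceq> V \<longleftrightarrow> U \<preceq> f \<Zsemi> V"
proof
  have simps [simp]: "f \<in> Arr B" "r \<in> Arr B" "Dom B r = Cod B f" "Cod B r = Dom B f"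
    and unit: "Ide B (Dom B f) \<preceq> f \<Zsemi> r" and counit: "r \<Zsemi> f \<preceq> Ide B (Cod B f)"
    using assms by (auto simp: right_adjoint_arrow_iff)
  {
    assume "r \<Zsemi> U \<preceq> V"
    then have 1: "f \<Zsemi> (r \<Zsemi> U) \<preceq> f \<Zsemi> V"
      using assms by (intro Comp_Leq) simp_all
    have "Ide B (Dom B f) \<Zsemi> U \<preceq> (f \<Zsemi> r) \<Zsemi> U"
      using assms unit by (intro Comp_Leq) simp_all
    then have 2: "U \<preceq> f \<Zsemi> (r \<Zsemi> U)"
      using assms by simp
    show "U \<preceq> f \<Zsemi> V"
      using Leq_trans[OF 2 1] assms by simp
  next
    assume "U \<preceq> f \<Zsemi> V"
    then have 1: "r \<Zsemi> U \<preceq> r \<Zsemi> (f \<Zsemi> V)"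
      using assms by (intro Comp_Leq) simp_all
    have "(r \<Zsemi> f) \<Zsemi> V \<preceq> Ide B (Cod B f) \<Zsemi> V"
      using assms counit by (intro Comp_Leq) simp_all
    then have 2: "r \<Zsemi> (f \<Zsemi> V) \<preceq> V"
      using assms by simp
    show "r \<Zsemi> U \<preceq> V"
      using Leq_trans[OF 1 2] assms by simp
  }
qed

text \<open>\<open>l\<close> is only required to agree with composition by \<open>r\<close> on the
  carrier, because the elementary condition prescribes its left adjoint as a meet.\<close>

lemma left_adjoint_Hom_functor:
  assumes "right_adjoint_arrow B f r"
    and l: "\<And>U. \<lbrakk>U \<in> Arr B; Dom B U = Dom B f; Cod B U = Unit B\<rbrakk> \<Longrightarrow> l U = r \<Zsemi> U"
  shows "left_adjoint (Hom_functor_obj B (Dom B f)) (Hom_functor_obj B (Cod B f)) l (Hom_functor_arr B f)"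
proof -
  have simps [simp]: "f \<in> Arr B" "r \<in> Arr B" "Dom B r = Cod B f" "Cod B r = Dom B f"
    using assms by (auto simp: right_adjoint_arrow_iff)
  show ?thesis
    unfolding left_adjoint_def Hom_functor_arr_def
    by (intro galois_connection.intro connection.intro galois_connection_axioms.intro; simp only: galcon.simps)
      (auto simp: Hom_functor_obj_order Hom_iff l right_adjoint_Leq_iff[OF assms(1)])
qed

end

section \<open>The doctrine\<close>

context cartesian_bicategory
begin

lemma Hom_meet_commute:
  assumes "R \<in> Arr B" "S \<in> Arr B" "Dom B S = Dom B R" "Cod B R = Unit B" "Cod B S = Unit B"
  shows "Hom_meet B R S = Hom_meet B S R"
  by (rule Leq_antisym)
    (use assms Hom_meet_lower[of R S] Hom_meet_lower[of S R] in \<open>simp_all add: Hom_meet_greatest\<close>)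

text \<open>\<open>Runit\<close> and \<open>Lunit\<close> agree at the unit, so the isomorphism that
  ends the meet can be read as \<open>Runit\<close>; by its naturality \<open>U\<close> slides to
  the end, behind the arrow computed in \<open>equality_restriction\<close>.\<close>

lemma equality_restriction_meet:
  assumes XA: "X \<in> Obj B" "A \<in> Obj B" and r: "right_adjoint_arrow B (Dup B A) r"
    and U: "U \<in> Arr B" "Dom B U = X \<odot> A" "Cod B U = Unit B"
  shows "Hom_meet B ((Ide B X \<otimes> proj1 B A A) \<Zsemi> U) (proj2 B X (A \<odot> A) \<Zsemi> (r \<Zsemi> Del B A)) = (Ide B X \<otimes> r) \<Zsemi> U"
proof -
  have [simp]: "r \<in> Arr B" "Dom B r = A \<odot> A" "Cod B r = A"
    using r XA by (auto simp: right_adjoint_arrow_iff)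
  have "Hom_meet B ((Ide B X \<otimes> proj1 B A A) \<Zsemi> U) (proj2 B X (A \<odot> A) \<Zsemi> (r \<Zsemi> Del B A))
    = (Dup B (X \<odot> (A \<odot> A)) \<Zsemi> ((Ide B X \<otimes> proj1 B A A) \<otimes> (proj2 B X (A \<odot> A) \<Zsemi> (r \<Zsemi> Del B A)))) \<Zsemi>
      ((U \<otimes> Ide B (Unit B)) \<Zsemi> Runit B (Unit B))"
    using XA U by (simp add: Hom_meet_def Runit_Unit)
  also have "\<dots> = (Dup B (X \<odot> (A \<odot> A)) \<Zsemi> ((Ide B X \<otimes> proj1 B A A) \<otimes> (proj2 B X (A \<odot> A) \<Zsemi> (r \<Zsemi> Del B A)))
      \<Zsemi> Runit B (X \<odot> A)) \<Zsemi> U"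
    using Runit_nat[of U] XA U by simp
  also have "\<dots> = (Ide B X \<otimes> r) \<Zsemi> U"
    by (simp only: equality_restriction[OF XA r])
  finally show ?thesis .
qed

lemma Hom_functor_elementary:
  assumes A: "A \<in> Obj B"
  obtains \<delta> where "\<delta> \<in> Hom B (A \<odot> A) (Unit B)"
    "\<And>X. X \<in> Obj B \<Longrightarrow> left_adjoint (Hom_functor_obj B (X \<odot> A)) (Hom_functor_obj B (X \<odot> (A \<odot> A)))
       (\<lambda>\<alpha>. Hom_functor_arr B (Ide B X \<otimes> proj1 B A A) \<alpha> \<sqinter>\<^bsub>Hom_functor_obj B (X \<odot> (A \<odot> A))\<^esub>
          Hom_functor_arr B (proj2 B X (A \<odot> A)) \<delta>)
       (Hom_functor_arr B (Ide B X \<otimes> Dup B A))"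
proof -
  obtain r where r: "right_adjoint_arrow B (Dup B A) r"
    using Dup_adjoint[OF A] by blast
  have [simp]: "r \<in> Arr B" "Dom B r = A \<odot> A" "Cod B r = A"
    using r A by (auto simp: right_adjoint_arrow_iff)
  show thesis
  proof (rule that)
    show "r \<Zsemi> Del B A \<in> Hom B (A \<odot> A) (Unit B)"
      using A by (simp add: Hom_iff)
    fix X assume X: "X \<in> Obj B"
    show "left_adjoint (Hom_functor_obj B (X \<odot> A)) (Hom_functor_obj B (X \<odot> (A \<odot> A)))
       (\<lambda>\<alpha>. Hom_functor_arr B (Ide B X \<otimes> proj1 B A A) \<alpha> \<sqinter>\<^bsub>Hom_functor_obj B (X \<odot> (A \<odot> A))\<^esub>
          Hom_functor_arr B (proj2 B X (A \<odot> A)) (r \<Zsemi> Del B A))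
       (Hom_functor_arr B (Ide B X \<otimes> Dup B A))"
      (is "left_adjoint _ _ ?l _")
    proof -
      have "left_adjoint (Hom_functor_obj B (Dom B (Ide B X \<otimes> Dup B A))) (Hom_functor_obj B (Cod B (Ide B X \<otimes> Dup B A)))
        ?l (Hom_functor_arr B (Ide B X \<otimes> Dup B A))"
      proof (rule left_adjoint_Hom_functor)
        show "right_adjoint_arrow B (Ide B X \<otimes> Dup B A) (Ide B X \<otimes> r)"
          using X r by (simp add: right_adjoint_Tensor right_adjoint_Ide)
        fix U assume "U \<in> Arr B" "Dom B U = Dom B (Ide B X \<otimes> Dup B A)" "Cod B U = Unit B"
        then have U: "U \<in> Arr B" "Dom B U = X \<odot> A" "Cod B U = Unit B"
          using X A by simp_all
        then show "?l U = (Ide B X \<otimes> r) \<Zsemi> U"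
          unfolding Hom_functor_arr_def equality_restriction_meet[OF X A r U, symmetric]
          using X A by (intro Hom_meet_eq) (simp_all add: Hom_iff)
      qed
      then show ?thesis using X A by simp
    qed
  qed
qed

text \<open>An arbitrary pullback square over \<open>p\<close> differs by an isomorphism from the one supplied by the third
  assumption, and the isomorphism transports the right adjoint \<open>s\<close> and the exchange law.\<close>

lemma Hom_functor_existential:
  assumes adj: "right_adjoint_arrow B p r"
    and frob: "\<And>\<alpha> \<beta>. \<lbrakk>\<alpha> \<in> Hom B (Cod B p) (Unit B); \<beta> \<in> Hom B (Dom B p) (Unit B)\<rbrakk>
      \<Longrightarrow> r \<Zsemi> Hom_meet B (p \<Zsemi> \<alpha>) \<beta> = Hom_meet B \<alpha> (r \<Zsemi> \<beta>)"
    and square: "\<And>f. \<lbrakk>map_arrow B f; Cod B f = Cod B p\<rbrakk>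
      \<Longrightarrow> \<exists>g q s. pullback (Map_category B) g q p f \<and> right_adjoint_arrow B q s \<and> s \<Zsemi> g = f \<Zsemi> r"
  shows "\<exists>ex. left_adjoint (Hom_functor_obj B (Dom B p)) (Hom_functor_obj B (Cod B p)) ex (Hom_functor_arr B p) \<and>
      (\<forall>f' p' f. pullback (Map_category B) f' p' p f \<longrightarrow>
         (\<exists>ex'. left_adjoint (Hom_functor_obj B (Dom B p')) (Hom_functor_obj B (Cod B p')) ex' (Hom_functor_arr B p') \<and>
            (\<forall>\<beta> \<in> Hom B (Dom B p) (Unit B).
               ex' (Hom_functor_arr B f' \<beta>) = Hom_functor_arr B f (ex \<beta>)))) \<and>
      (\<forall>\<alpha> \<in> Hom B (Cod B p) (Unit B). \<forall>\<beta> \<in> Hom B (Dom B p) (Unit B).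
         ex (Hom_functor_arr B p \<alpha> \<sqinter>\<^bsub>Hom_functor_obj B (Dom B p)\<^esub> \<beta>)
           = \<alpha> \<sqinter>\<^bsub>Hom_functor_obj B (Cod B p)\<^esub> ex \<beta>)"
proof (rule exI[of _ "\<lambda>U. r \<Zsemi> U"], intro conjI allI impI ballI)
  have simps [simp]: "p \<in> Arr B" "r \<in> Arr B" "Dom B r = Cod B p" "Cod B r = Dom B p"
    using adj by (auto simp: right_adjoint_arrow_iff)
  interpret M: cartesian_category "Map_category B" by (rule cartesian_category_Map)
  show "left_adjoint (Hom_functor_obj B (Dom B p)) (Hom_functor_obj B (Cod B p)) (\<lambda>U. r \<Zsemi> U) (Hom_functor_arr B p)"
    by (rule left_adjoint_Hom_functor[OF adj]) simp
  show "r \<Zsemi> (Hom_functor_arr B p \<alpha> \<sqinter>\<^bsub>Hom_functor_obj B (Dom B p)\<^esub> \<beta>)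
      = \<alpha> \<sqinter>\<^bsub>Hom_functor_obj B (Cod B p)\<^esub> (r \<Zsemi> \<beta>)"
    if "\<alpha> \<in> Hom B (Cod B p) (Unit B)" "\<beta> \<in> Hom B (Dom B p) (Unit B)" for \<alpha> \<beta>
    using that frob[OF that] by (simp add: Hom_functor_arr_def Hom_meet_eq Hom_iff)
  fix f' p' f assume pb: "pullback (Map_category B) f' p' p f"
  then have f: "map_arrow B f" "Cod B f = Cod B p" "map_arrow B f'" "Cod B f' = Dom B p" "map_arrow B p'"
    "Dom B f' = Dom B p'" "Cod B p' = Dom B f"
    by (simp_all add: pullback_def)
  obtain g q s where gqs: "pullback (Map_category B) g q p f" "right_adjoint_arrow B q s" "s \<Zsemi> g = f \<Zsemi> r"
    using square[OF f(1,2)] by blast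
  have q [simp]: "q \<in> Arr B" "s \<in> Arr B" "Dom B s = Cod B q" "Cod B s = Dom B q"
    using gqs(2) by (auto simp: right_adjoint_arrow_iff)
  obtain u v where uv: "inverse_arrows (Map_category B) v u" "Dom B v = Dom B p'" "Cod B v = Dom B q"
      "u \<Zsemi> f' = g" "v \<Zsemi> q = p'"
    using M.pullback_unique[OF pb gqs(1), unfolded Map_category_simps] by blast
  then have inv: "inverse_arrows B v u" and u: "u \<in> Arr B" "Dom B u = Dom B q" "Cod B u = Dom B p'"
    by (simp_all add: inverse_arrows_def Hom_def)
  have adj': "right_adjoint_arrow B p' (s \<Zsemi> u)"
    using right_adjoint_Comp[OF right_adjoint_inverse[OF inv] gqs(2) uv(3)] uv(5) by simp
  show "\<exists>ex'. left_adjoint (Hom_functor_obj B (Dom B p')) (Hom_functor_obj B (Cod B p')) ex' (Hom_functor_arr B p') \<and>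
    (\<forall>\<beta> \<in> Hom B (Dom B p) (Unit B). ex' (Hom_functor_arr B f' \<beta>) = Hom_functor_arr B f (r \<Zsemi> \<beta>))"
  proof (intro exI[of _ "\<lambda>U. (s \<Zsemi> u) \<Zsemi> U"] conjI ballI)
    show "left_adjoint (Hom_functor_obj B (Dom B p')) (Hom_functor_obj B (Cod B p')) (\<lambda>U. (s \<Zsemi> u) \<Zsemi> U) (Hom_functor_arr B p')"
      by (rule left_adjoint_Hom_functor[OF adj']) simp
    fix \<beta> assume "\<beta> \<in> Hom B (Dom B p) (Unit B)"
    then have \<beta>: "\<beta> \<in> Arr B" "Dom B \<beta> = Dom B p" by (simp_all add: Hom_iff)
    have "(s \<Zsemi> u) \<Zsemi> (f' \<Zsemi> \<beta>) = (s \<Zsemi> (u \<Zsemi> f')) \<Zsemi> \<beta>"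
      using \<beta> u f by simp
    also have "\<dots> = f \<Zsemi> (r \<Zsemi> \<beta>)"
      unfolding uv(4) gqs(3) using \<beta> f by simp
    finally show "(s \<Zsemi> u) \<Zsemi> Hom_functor_arr B f' \<beta> = Hom_functor_arr B f (r \<Zsemi> \<beta>)"
      by (simp add: Hom_functor_arr_def)
  qed
qed

text \<open>The mediating arrow pairs \<open>k\<close> with the second component of
  \<open>h\<close>; the first component of \<open>h\<close> is already fixed as
  \<open>k \<Zsemi> f\<close> by commutativity.\<close>

lemma pullback_proj1:
  assumes f: "map_arrow B f" "Cod B f = X" and Y: "Y \<in> Obj B"
  shows "pullback (Map_category B) (f \<otimes> Ide B Y) (proj1 B (Dom B f) Y) (proj1 B X Y) f"
  unfolding pullback_def Map_category_simps Map_Hom_iff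
proof (intro conjI ballI impI)
  have X: "X \<in> Obj B" using f by auto
  fix T h k assume T: "T \<in> Obj B"
    and "h \<in> Hom (Map_category B) T (Dom B (proj1 B X Y))" "k \<in> Hom (Map_category B) T (Dom B f)"
    and eq: "h \<Zsemi> proj1 B X Y = k \<Zsemi> f"
  then have hk: "map_arrow B h" "Dom B h = T" "Cod B h = X \<odot> Y" "map_arrow B k" "Dom B k = T" "Cod B k = Dom B f"
    using X Y by (simp_all add: Map_Hom_iff)
  show "\<exists>!u. (map_arrow B u \<and> Dom B u = T \<and> Cod B u = Dom B (f \<otimes> Ide B Y)) \<and> u \<Zsemi> (f \<otimes> Ide B Y) = h \<and> u \<Zsemi> proj1 B (Dom B f) Y = k"
  proof (rule ex1I[of _ "Dup B T \<Zsemi> (k \<otimes> (h \<Zsemi> proj2 B X Y))"])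
    have "(Dup B T \<Zsemi> (k \<otimes> (h \<Zsemi> proj2 B X Y))) \<Zsemi> (f \<otimes> Ide B Y) = h"
      by (rule map_arrow_eqI[of _ _ X Y]) (use f X Y T hk eq in simp_all)
    then show "(map_arrow B (Dup B T \<Zsemi> (k \<otimes> (h \<Zsemi> proj2 B X Y))) \<and> Dom B (Dup B T \<Zsemi> (k \<otimes> (h \<Zsemi> proj2 B X Y))) = T \<and>
        Cod B (Dup B T \<Zsemi> (k \<otimes> (h \<Zsemi> proj2 B X Y))) = Dom B (f \<otimes> Ide B Y)) \<and>
      (Dup B T \<Zsemi> (k \<otimes> (h \<Zsemi> proj2 B X Y))) \<Zsemi> (f \<otimes> Ide B Y) = h \<and>
      (Dup B T \<Zsemi> (k \<otimes> (h \<Zsemi> proj2 B X Y))) \<Zsemi> proj1 B (Dom B f) Y = k"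
      using f X Y T hk by simp
  next
    fix u assume u: "(map_arrow B u \<and> Dom B u = T \<and> Cod B u = Dom B (f \<otimes> Ide B Y)) \<and>
      u \<Zsemi> (f \<otimes> Ide B Y) = h \<and> u \<Zsemi> proj1 B (Dom B f) Y = k"
    then have "h \<Zsemi> proj2 B X Y = u \<Zsemi> proj2 B (Dom B f) Y"
      using f X Y by (auto simp: proj_simps)
    then show "u = Dup B T \<Zsemi> (k \<otimes> (h \<Zsemi> proj2 B X Y))"
      using map_arrow_pair_proj[of u "Dom B f" Y] u f Y by simp
  qed
qed (use assms in auto)

lemma pullback_proj2:
  assumes f: "map_arrow B f" "Cod B f = Y" and X: "X \<in> Obj B"
  shows "pullback (Map_category B) (Ide B X \<otimes> f) (proj2 B X (Dom B f)) (proj2 B X Y) f"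
  unfolding pullback_def Map_category_simps Map_Hom_iff
proof (intro conjI ballI impI)
  have Y: "Y \<in> Obj B" using f by auto
  fix T h k assume T: "T \<in> Obj B"
    and "h \<in> Hom (Map_category B) T (Dom B (proj2 B X Y))" "k \<in> Hom (Map_category B) T (Dom B f)"
    and eq: "h \<Zsemi> proj2 B X Y = k \<Zsemi> f"
  then have hk: "map_arrow B h" "Dom B h = T" "Cod B h = X \<odot> Y" "map_arrow B k" "Dom B k = T" "Cod B k = Dom B f"
    using X Y by (simp_all add: Map_Hom_iff)
  show "\<exists>!u. (map_arrow B u \<and> Dom B u = T \<and> Cod B u = Dom B (Ide B X \<otimes> f)) \<and> u \<Zsemi> (Ide B X \<otimes> f) = h \<and> u \<Zsemi> proj2 B X (Dom B f) = k"
  proof (rule ex1I[of _ "Dup B T \<Zsemi> ((h \<Zsemi> proj1 B X Y) \<otimes> k)"])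
    have "(Dup B T \<Zsemi> ((h \<Zsemi> proj1 B X Y) \<otimes> k)) \<Zsemi> (Ide B X \<otimes> f) = h"
      by (rule map_arrow_eqI[of _ _ X Y]) (use f X Y T hk eq in simp_all)
    then show "(map_arrow B (Dup B T \<Zsemi> ((h \<Zsemi> proj1 B X Y) \<otimes> k)) \<and> Dom B (Dup B T \<Zsemi> ((h \<Zsemi> proj1 B X Y) \<otimes> k)) = T \<and>
        Cod B (Dup B T \<Zsemi> ((h \<Zsemi> proj1 B X Y) \<otimes> k)) = Dom B (Ide B X \<otimes> f)) \<and>
      (Dup B T \<Zsemi> ((h \<Zsemi> proj1 B X Y) \<otimes> k)) \<Zsemi> (Ide B X \<otimes> f) = h \<and>
      (Dup B T \<Zsemi> ((h \<Zsemi> proj1 B X Y) \<otimes> k)) \<Zsemi> proj2 B X (Dom B f) = k"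
      using f X Y T hk by simp
  next
    fix u assume u: "(map_arrow B u \<and> Dom B u = T \<and> Cod B u = Dom B (Ide B X \<otimes> f)) \<and>
      u \<Zsemi> (Ide B X \<otimes> f) = h \<and> u \<Zsemi> proj2 B X (Dom B f) = k"
    then have "h \<Zsemi> proj1 B X Y = u \<Zsemi> proj1 B X (Dom B f)"
      using f X Y by (auto simp: proj_simps)
    then show "u = Dup B T \<Zsemi> ((h \<Zsemi> proj1 B X Y) \<otimes> k)"
      using map_arrow_pair_proj[of u X "Dom B f"] u f X by simp
  qed
qed (use assms in auto)

text \<open>The meet with a reindexed predicate contains the graph of the projection. Moving
  \<open>r\<close> past that graph leaves \<open>Dup X\<close> with \<open>r\<close> on the second
  argument only.\<close>

lemma proj1_frobenius:
  assumes X: "X \<in> Obj B" and e: "e \<in> Arr B" "Dom B e = Unit B" "Cod B e = Y"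
    and \<alpha>: "\<alpha> \<in> Hom B X (Unit B)" and \<beta>: "\<beta> \<in> Hom B (X \<odot> Y) (Unit B)"
  defines "r \<equiv> inv_arrow B (Runit B X) \<Zsemi> (Ide B X \<otimes> e)"
  shows "r \<Zsemi> Hom_meet B (proj1 B X Y \<Zsemi> \<alpha>) \<beta> = Hom_meet B \<alpha> (r \<Zsemi> \<beta>)"
proof -
  have Y: "Y \<in> Obj B" using e by auto
  have r: "r \<in> Arr B" "Dom B r = X" "Cod B r = X \<odot> Y" using X e by (simp_all add: r_def)
  have "r \<Zsemi> Hom_meet B (proj1 B X Y \<Zsemi> \<alpha>) \<beta>
    = (r \<Zsemi> (Dup B (X \<odot> Y) \<Zsemi> (proj1 B X Y \<otimes> Ide B (X \<odot> Y)))) \<Zsemi> ((\<alpha> \<otimes> \<beta>) \<Zsemi> Lunit B (Unit B))"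
    using X Y r \<alpha> \<beta> by (simp add: Hom_meet_def Hom_iff)
  also have "\<dots> = Hom_meet B \<alpha> (r \<Zsemi> \<beta>)"
    unfolding r_def proj1_adjoint_graph[OF X e]
    using X Y r \<alpha> \<beta> by (simp add: Hom_meet_def Hom_iff flip: r_def)
  finally show ?thesis .
qed

text \<open>The graph of the second projection has the identity first, so the reindexed predicate is
  commuted to second place and the result is commuted back.\<close>

lemma proj2_frobenius:
  assumes Y: "Y \<in> Obj B" and e: "e \<in> Arr B" "Dom B e = Unit B" "Cod B e = X"
    and \<alpha>: "\<alpha> \<in> Hom B Y (Unit B)" and \<beta>: "\<beta> \<in> Hom B (X \<odot> Y) (Unit B)"
  defines "r \<equiv> inv_arrow B (Lunit B Y) \<Zsemi> (e \<otimes> Ide B Y)"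
  shows "r \<Zsemi> Hom_meet B (proj2 B X Y \<Zsemi> \<alpha>) \<beta> = Hom_meet B \<alpha> (r \<Zsemi> \<beta>)"
proof -
  have X: "X \<in> Obj B" using e by auto
  have r: "r \<in> Arr B" "Dom B r = Y" "Cod B r = X \<odot> Y" using Y e by (simp_all add: r_def)
  have "r \<Zsemi> Hom_meet B (proj2 B X Y \<Zsemi> \<alpha>) \<beta> = r \<Zsemi> Hom_meet B \<beta> (proj2 B X Y \<Zsemi> \<alpha>)"
    using Hom_meet_commute[of \<beta> "proj2 B X Y \<Zsemi> \<alpha>"] X Y \<alpha> \<beta> by (simp add: Hom_iff)
  also have "\<dots> = (r \<Zsemi> (Dup B (X \<odot> Y) \<Zsemi> (Ide B (X \<odot> Y) \<otimes> proj2 B X Y))) \<Zsemi> ((\<beta> \<otimes> \<alpha>) \<Zsemi> Lunit B (Unit B))"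
    using X Y r \<alpha> \<beta> by (simp add: Hom_meet_def Hom_iff)
  also have "\<dots> = Hom_meet B (r \<Zsemi> \<beta>) \<alpha>"
    unfolding r_def proj2_adjoint_graph[OF Y e]
    using X Y r \<alpha> \<beta> by (simp add: Hom_meet_def Hom_iff flip: r_def)
  also have "\<dots> = Hom_meet B \<alpha> (r \<Zsemi> \<beta>)"
    using Hom_meet_commute[of \<alpha> "r \<Zsemi> \<beta>"] X Y r \<alpha> \<beta> by (simp add: Hom_iff)
  finally show ?thesis .
qed

text \<open>\<open>f\<close> acts on one factor while \<open>e\<close> creates the other. After
  naturality of the inverse unitor, both orders amount to \<open>f \<otimes> e\<close>.\<close>

lemma proj1_square:
  assumes f: "map_arrow B f" "Cod B f = X" and e: "right_adjoint_arrow B (Del B Y) e" and Y: "Y \<in> Obj B"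
  shows "\<exists>g q s. pullback (Map_category B) g q (proj1 B X Y) f \<and> right_adjoint_arrow B q s \<and>
    s \<Zsemi> g = f \<Zsemi> (inv_arrow B (Runit B X) \<Zsemi> (Ide B X \<otimes> e))"
proof (intro exI conjI)
  have e_simps [simp]: "e \<in> Arr B" "Dom B e = Unit B" "Cod B e = Y"
    using e Y by (auto simp: right_adjoint_arrow_iff)
  show "pullback (Map_category B) (f \<otimes> Ide B Y) (proj1 B (Dom B f) Y) (proj1 B X Y) f"
    by (rule pullback_proj1[OF f Y])
  show "right_adjoint_arrow B (proj1 B (Dom B f) Y) (inv_arrow B (Runit B (Dom B f)) \<Zsemi> (Ide B (Dom B f) \<otimes> e))"
    using f e Y by (simp add: proj1_adjoint)
  have "(f \<Zsemi> inv_arrow B (Runit B X)) \<Zsemi> (Ide B X \<otimes> e)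
    = inv_arrow B (Runit B (Dom B f)) \<Zsemi> ((f \<otimes> Ide B (Unit B)) \<Zsemi> (Ide B X \<otimes> e))"
    using f inv_Runit_nat[of f] by auto
  then show "(inv_arrow B (Runit B (Dom B f)) \<Zsemi> (Ide B (Dom B f) \<otimes> e)) \<Zsemi> (f \<otimes> Ide B Y)
    = f \<Zsemi> (inv_arrow B (Runit B X) \<Zsemi> (Ide B X \<otimes> e))"
    using f Y by auto
qed

lemma proj2_square:
  assumes f: "map_arrow B f" "Cod B f = Y" and e: "right_adjoint_arrow B (Del B X) e" and X: "X \<in> Obj B"
  shows "\<exists>g q s. pullback (Map_category B) g q (proj2 B X Y) f \<and> right_adjoint_arrow B q s \<and>
    s \<Zsemi> g = f \<Zsemi> (inv_arrow B (Lunit B Y) \<Zsemi> (e \<otimes> Ide B Y))"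
proof (intro exI conjI)
  have e_simps [simp]: "e \<in> Arr B" "Dom B e = Unit B" "Cod B e = X"
    using e X by (auto simp: right_adjoint_arrow_iff)
  show "pullback (Map_category B) (Ide B X \<otimes> f) (proj2 B X (Dom B f)) (proj2 B X Y) f"
    by (rule pullback_proj2[OF f X])
  show "right_adjoint_arrow B (proj2 B X (Dom B f)) (inv_arrow B (Lunit B (Dom B f)) \<Zsemi> (e \<otimes> Ide B (Dom B f)))"
    using f e X by (simp add: proj2_adjoint)
  have "(f \<Zsemi> inv_arrow B (Lunit B Y)) \<Zsemi> (e \<otimes> Ide B Y)
    = inv_arrow B (Lunit B (Dom B f)) \<Zsemi> ((Ide B (Unit B) \<otimes> f) \<Zsemi> (e \<otimes> Ide B Y))"
    using f inv_Lunit_nat[of f] by auto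
  then show "(inv_arrow B (Lunit B (Dom B f)) \<Zsemi> (e \<otimes> Ide B (Dom B f))) \<Zsemi> (Ide B X \<otimes> f)
    = f \<Zsemi> (inv_arrow B (Lunit B Y) \<Zsemi> (e \<otimes> Ide B Y))"
    using f X by auto
qed

text \<open>Rebuilding a map from its projections evaluates the pairings demanded by the doctrine:
  dropping the last factor is \<open>Ide B X \<otimes> proj1 B A A\<close>, keeping the last two is
  a single projection.\<close>

lemma Map_triple_projections:
  assumes "X \<in> Obj B" "A \<in> Obj B"
  shows "pairing (Map_category B) (proj1 B X (A \<odot> A)) (proj2 B X (A \<odot> A) \<Zsemi> proj1 B A A) = Ide B X \<otimes> proj1 B A A"
    "pairing (Map_category B) (proj2 B X (A \<odot> A) \<Zsemi> proj1 B A A) (proj2 B X (A \<odot> A) \<Zsemi> proj2 B A A) = proj2 B X (A \<odot> A)"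
    "prod_arrow (Map_category B) (Ide B X) (diagonal (Map_category B) A) = Ide B X \<otimes> Dup B A"
  using assms map_arrow_pair_proj[of "Ide B X \<otimes> proj1 B A A" X A] map_arrow_pair_proj[of "proj2 B X (A \<odot> A)" A A]
  by (simp_all add: Map_pairing Map_prod_arrow Map_diagonal)

lemma Hom_functor_doctrine:
  "elementary_existential_doctrine (Map_category B) (Hom_functor_obj B) (Hom_functor_arr B)"
proof (intro elementary_existential_doctrine.intro elementary_existential_doctrine_axioms.intro
    cartesian_category_Map InfSL_functor_Hom)
  fix A assume "A \<in> Obj (Map_category B)"
  then have A: "A \<in> Obj B" by simp
  obtain \<delta> where "\<delta> \<in> Hom B (A \<odot> A) (Unit B)"
    "\<And>X. X \<in> Obj B \<Longrightarrow> left_adjoint (Hom_functor_obj B (X \<odot> A)) (Hom_functor_obj B (X \<odot> (A \<odot> A)))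
       (\<lambda>\<alpha>. Hom_functor_arr B (Ide B X \<otimes> proj1 B A A) \<alpha> \<sqinter>\<^bsub>Hom_functor_obj B (X \<odot> (A \<odot> A))\<^esub>
          Hom_functor_arr B (proj2 B X (A \<odot> A)) \<delta>)
       (Hom_functor_arr B (Ide B X \<otimes> Dup B A))"
    using Hom_functor_elementary[OF A] by blast
  then show "\<exists>\<delta> \<in> carrier (Hom_functor_obj B (A \<Otimes>\<^bsub>Map_category B\<^esub> A)). \<forall>X \<in> Obj (Map_category B).
      let \<pi>\<^sub>1 = Fst (Map_category B) X (A \<Otimes>\<^bsub>Map_category B\<^esub> A);
          \<pi>\<^sub>2 = Snd (Map_category B) X (A \<Otimes>\<^bsub>Map_category B\<^esub> A) \<Zsemi>\<^bsub>Map_category B\<^esub> Fst (Map_category B) A A;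
          \<pi>\<^sub>3 = Snd (Map_category B) X (A \<Otimes>\<^bsub>Map_category B\<^esub> A) \<Zsemi>\<^bsub>Map_category B\<^esub> Snd (Map_category B) A A;
          e = prod_arrow (Map_category B) (Ide (Map_category B) X) (diagonal (Map_category B) A)
      in left_adjoint (Hom_functor_obj B (X \<Otimes>\<^bsub>Map_category B\<^esub> A))
           (Hom_functor_obj B (X \<Otimes>\<^bsub>Map_category B\<^esub> (A \<Otimes>\<^bsub>Map_category B\<^esub> A)))
           (\<lambda>\<alpha>. Hom_functor_arr B (pairing (Map_category B) \<pi>\<^sub>1 \<pi>\<^sub>2) \<alpha>
              \<sqinter>\<^bsub>Hom_functor_obj B (X \<Otimes>\<^bsub>Map_category B\<^esub> (A \<Otimes>\<^bsub>Map_category B\<^esub> A))\<^esub>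
              Hom_functor_arr B (pairing (Map_category B) \<pi>\<^sub>2 \<pi>\<^sub>3) \<delta>)
           (Hom_functor_arr B e)"
    by (intro bexI[of _ \<delta>]) (simp_all add: Let_def A Map_triple_projections)
next
  fix p assume "projection (Map_category B) p"
  then obtain X Y where XY: "X \<in> Obj B" "Y \<in> Obj B" and "p = proj1 B X Y \<or> p = proj2 B X Y"
    by (auto simp: projection_def)
  then consider "p = proj1 B X Y" | "p = proj2 B X Y" by blast
  then show "\<exists>ex. left_adjoint (Hom_functor_obj B (Dom (Map_category B) p)) (Hom_functor_obj B (Cod (Map_category B) p))
        ex (Hom_functor_arr B p) \<and>
      (\<forall>f' p' f. pullback (Map_category B) f' p' p f \<longrightarrow>
         (\<exists>ex'. left_adjoint (Hom_functor_obj B (Dom (Map_category B) p')) (Hom_functor_obj B (Cod (Map_category B) p'))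
              ex' (Hom_functor_arr B p') \<and>
            (\<forall>\<beta> \<in> carrier (Hom_functor_obj B (Dom (Map_category B) p)).
               ex' (Hom_functor_arr B f' \<beta>) = Hom_functor_arr B f (ex \<beta>)))) \<and>
      (\<forall>\<alpha> \<in> carrier (Hom_functor_obj B (Cod (Map_category B) p)).
         \<forall>\<beta> \<in> carrier (Hom_functor_obj B (Dom (Map_category B) p)).
         ex (Hom_functor_arr B p \<alpha> \<sqinter>\<^bsub>Hom_functor_obj B (Dom (Map_category B) p)\<^esub> \<beta>)
           = \<alpha> \<sqinter>\<^bsub>Hom_functor_obj B (Cod (Map_category B) p)\<^esub> ex \<beta>)"
  proof cases
    case p: 1
    obtain e where e: "right_adjoint_arrow B (Del B Y) e" using Del_adjoint[OF XY(2)] by blast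
    then have e': "e \<in> Arr B" "Dom B e = Unit B" "Cod B e = Y"
      using XY by (auto simp: right_adjoint_arrow_iff)
    show ?thesis
      unfolding p Map_category_simps Hom_functor_obj_simps
      \<comment> \<open>The right adjoint stays bracketed as a single arrow, the form in which the
        Frobenius and square lemmas mention it.\<close>
      by (rule Hom_functor_existential[OF proj1_adjoint[OF e XY]])
        (use XY e' proj1_square[OF _ _ e XY(2), of _ X] in \<open>simp_all del: Comp_assoc_simp add: proj1_frobenius\<close>)
  next
    case p: 2
    obtain e where e: "right_adjoint_arrow B (Del B X) e" using Del_adjoint[OF XY(1)] by blast
    then have e': "e \<in> Arr B" "Dom B e = Unit B" "Cod B e = X"
      using XY by (auto simp: right_adjoint_arrow_iff)
    show ?thesis
      unfolding p Map_category_simps Hom_functor_obj_simps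
      by (rule Hom_functor_existential[OF proj2_adjoint[OF e XY]])
        (use XY e' proj2_square[OF _ _ e XY(1), of _ Y] in \<open>simp_all del: Comp_assoc_simp add: proj2_frobenius\<close>)
  qed
qed

end

theorem theorem5p1:
  fixes B :: "('o, 'a, 'z) cartesian_bicategory_scheme"
  assumes "cartesian_bicategory B"
  shows "elementary_existential_doctrine (Map_category B) (Hom_functor_obj B) (Hom_functor_arr B)"
  using assms by (rule cartesian_bicategory.Hom_functor_doctrine)

end
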